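(* There exists an algorithm that, given as input a well-conditioned instance of the scaling problem with shift, that is, exponents $\omega_1,\dots,\omega_k\in\mathbb{R}^n$, coefficients $q\in\mathbb{R}^k$ with all $q_i>0$, a shift $\theta$ in the relative interior of $\operatorname{conv}\Omega$ where $\Omega=\{\omega_1,\dots,\omega_k\}$, and a precision $\epsilon>0$, returns $x_\epsilon\in\mathbb{R}^n$ such that $$\|\nabla F_\theta(x_\epsilon)\|_2=\|\nabla F(x_\epsilon)-\theta\|_2\le\epsilon$$ within $$O\!\left(\sqrt{k}\,\log\!\left(k\,\frac{R_\theta}{r_\theta}\,\frac{R_\theta}{\epsilon}\,\log(k\beta)\right)\right)$$ iterations.
   Context: $\log$ is the natural logarithm and the constant implicit in $O(\cdot)$ is absolute. For $x\in\mathbb{R}^n$, $F(x)=\log\sum_{i=1}^k q_i e^{\langle \omega_i,x\rangle}$ and $F_\theta(x)=F(x)-\langle\theta,x\rangle=\log\sum_{i=1}^k q_i e^{\langle \omega_i-\theta,x\rangle}$. - $r_\theta=\max\{r\ge 0: B(\theta,r)\cap\operatorname{aff}\Omega\subseteq\operatorname{conv}\Omega\}$ is the distance from $\theta$ to the relative boundary of $\operatorname{conv}\Omega$, where $B(\theta,r)$ is the closed Euclidean ball and $\operatorname{aff}$ denotes the affine hull. The instance is called well-conditioned if $r_\theta>0$, i.e. if $\theta$ is in the relative interior of $\operatorname{conv}\Omega$. - $R_\theta=\max_{i\in[k]}\|\omega_i-\theta\|_2$. - $\beta=\|q\|_1/\min_{i\in[k]}q_i$. The algorithm is an interior-point method,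 and an iteration is one Newton step $p\mapsto p-(\nabla^2\Phi(p))^{-1}\nabla\Phi(p)$ for a known function $\Phi$ that is the sum of a linear function and the barrier $$\Psi(x,z,t)=-\sum_i\log z_i-\sum_i\log\bigl(\log z_i-\langle\omega_i-\theta,x\rangle+t-\log q_i\bigr)-\log\bigl(\log(5k\|q\|_1)-t\bigr)-\log\bigl(1-\textstyle\sum_iz_i\bigr)$$ in the variables $p=(x,z,t)\in W\times\mathbb{R}^k\times\mathbb{R}$, with $W=\operatorname{span}\{\omega_1-\theta,\dots,\omega_k-\theta\}$. *)

theory Defs
  imports "HOL-Analysis.Analysis"
begin

section \<open>All Euclidean spaces inside one inner product space\<close>

text \<open>
  The dimension n is an input of the algorithm, and both the algorithm and the constant in the
  O-notation must be chosen before n. As n cannot be a type then, \<open>R^n\<close> is taken to be the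
  subspace \<open>Rn n\<close> of those finitely supported real sequences that vanish from index n on, with the
  Euclidean inner product. Vector indices run over \<open>{..<n}\<close>, and indices of exponents and
  coefficients over \<open>{..<k}\<close>.
\<close>

typedef fseq = "{f :: nat \<Rightarrow> real. finite {i. f i \<noteq> 0}}"
  morphisms coord Abs_fseq
  by (rule exI[of _ "\<lambda>_. 0"]) simp

setup_lifting type_definition_fseq

lemma finite_supp [simp]: "finite {i. coord x i \<noteq> 0}"
  using coord[of x] by simp

lemma fseq_eqI: "(\<And>i. coord x i = coord y i) \<Longrightarrow> x = y"
  by (metis coord_inject ext)

instantiation fseq :: real_vector
begin

lift_definition zero_fseq :: fseq is "\<lambda>_. 0" by simp

lift_definition plus_fseq :: "fseq \<Rightarrow> fseq \<Rightarrow> fseq" is "\<lambda>f g i. f i + g i"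
proof -
  fix f g :: "nat \<Rightarrow> real"
  assume "finite {i. f i \<noteq> 0}" "finite {i. g i \<noteq> 0}"
  then show "finite {i. f i + g i \<noteq> 0}"
    by (rule_tac finite_subset[of _ "{i. f i \<noteq> 0} \<union> {i. g i \<noteq> 0}"]) auto
qed

lift_definition uminus_fseq :: "fseq \<Rightarrow> fseq" is "\<lambda>f i. - f i" by simp

definition minus_fseq :: "fseq \<Rightarrow> fseq \<Rightarrow> fseq" where
  "minus_fseq x y = x + (- y)"

lift_definition scaleR_fseq :: "real \<Rightarrow> fseq \<Rightarrow> fseq" is "\<lambda>c f i. c * f i"
  by (rule finite_subset) auto

lemma coord_arith:
  "coord 0 i = 0" "coord (x + y) i = coord x i + coord y i" "coord (- x) i = - coord x i"
  "coord (x - y) i = coord x i - coord y i" "coord (scaleR c x) i = c * coord x i"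
  by (auto simp: zero_fseq.rep_eq plus_fseq.rep_eq uminus_fseq.rep_eq minus_fseq_def
      scaleR_fseq.rep_eq)

instance
proof
  fix x y z :: fseq and a b :: real
  show "x + y + z = x + (y + z)" "x + y = y + x" "0 + x = x" "- x + x = 0" "x - y = x + - y"
    "a *\<^sub>R (x + y) = a *\<^sub>R x + a *\<^sub>R y" "(a + b) *\<^sub>R x = a *\<^sub>R x + b *\<^sub>R x"
    "a *\<^sub>R b *\<^sub>R x = (a * b) *\<^sub>R x" "1 *\<^sub>R x = x"
    by (auto intro!: fseq_eqI simp: coord_arith algebra_simps)
qed

end

instantiation fseq :: real_inner
begin

definition inner_fseq :: "fseq \<Rightarrow> fseq \<Rightarrow> real" where
  "inner_fseq x y = (\<Sum>i | coord x i \<noteq> 0. coord x i * coord y i)"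

definition norm_fseq :: "fseq \<Rightarrow> real" where
  "norm_fseq x = sqrt (inner x x)"

definition sgn_fseq :: "fseq \<Rightarrow> fseq" where
  "sgn_fseq x = x /\<^sub>R norm x"

definition dist_fseq :: "fseq \<Rightarrow> fseq \<Rightarrow> real" where
  "dist_fseq x y = norm (x - y)"

definition uniformity_fseq :: "(fseq \<times> fseq) filter" where
  "uniformity_fseq = (INF e\<in>{0<..}. principal {(x, y). dist x y < e})"

definition open_fseq :: "fseq set \<Rightarrow> bool" where
  "open_fseq U = (\<forall>x\<in>U. \<forall>\<^sub>F (x', y) in uniformity. x' = x \<longrightarrow> y \<in> U)"

lemma inner_fseq_superset:
  assumes "finite A" "{i. coord x i \<noteq> 0} \<subseteq> A"
  shows "inner x y = (\<Sum>i\<in>A. coord x i * coord y i)"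
  unfolding inner_fseq_def using assms by (intro sum.mono_neutral_left) auto

instance
proof
  fix x y z :: fseq and a :: real
  show "sgn x = x /\<^sub>R norm x" by (rule sgn_fseq_def)
  show "dist x y = norm (x - y)" by (rule dist_fseq_def)
  show "uniformity = (INF e\<in>{0 <..}. principal {(x, y :: fseq). dist x y < e})"
    by (rule uniformity_fseq_def)
  show "open U = (\<forall>x\<in>U. \<forall>\<^sub>F (x', y) in uniformity. x' = x \<longrightarrow> y \<in> U)" for U :: "fseq set"
    by (rule open_fseq_def)
  define A where
    "A = {i. coord x i \<noteq> 0} \<union> {i. coord y i \<noteq> 0} \<union> {i. coord (x + y) i \<noteq> 0} \<union> {i. coord (a *\<^sub>R x) i \<noteq> 0}"
  have fin: "finite A" by (simp add: A_def)
  have eq: "inner u v = (\<Sum>i\<in>A. coord u i * coord v i)"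
    if "{i. coord u i \<noteq> 0} \<subseteq> A" for u v
    using inner_fseq_superset[OF fin that] .
  have sub: "{i. coord x i \<noteq> 0} \<subseteq> A" "{i. coord y i \<noteq> 0} \<subseteq> A"
    "{i. coord (x + y) i \<noteq> 0} \<subseteq> A" "{i. coord (a *\<^sub>R x) i \<noteq> 0} \<subseteq> A"
    by (auto simp: A_def)
  show "inner x y = inner y x"
    unfolding eq[OF sub(1)] eq[OF sub(2)] by (simp add: mult.commute)
  show "inner (x + y) z = inner x z + inner y z"
    unfolding eq[OF sub(1)] eq[OF sub(2)] eq[OF sub(3)]
    by (simp add: coord_arith algebra_simps sum.distrib)
  show "inner (a *\<^sub>R x) y = a * inner x y"
    unfolding eq[OF sub(1)] eq[OF sub(4)] by (simp add: coord_arith sum_distrib_left mult.assoc)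
  show "0 \<le> inner x x"
    unfolding inner_fseq_def by (intro sum_nonneg) auto
  show "inner x x = 0 \<longleftrightarrow> x = 0"
  proof
    assume "inner x x = 0"
    then have "\<forall>i\<in>{i. coord x i \<noteq> 0}. coord x i * coord x i = 0"
      unfolding inner_fseq_def by (subst (asm) sum_nonneg_eq_0_iff) auto
    then show "x = 0" by (intro fseq_eqI) (auto simp: coord_arith)
  qed (simp add: inner_fseq_def coord_arith)
  show "norm x = sqrt (inner x x)" by (rule norm_fseq_def)
qed

end

definition Rn :: "nat \<Rightarrow> fseq set" where
  "Rn n = {x. \<forall>i\<ge>n. coord x i = 0}"

lift_definition vector :: "nat \<Rightarrow> (nat \<Rightarrow> real) \<Rightarrow> fseq" is "\<lambda>n f i. if i < n then f i else 0"
  by simp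

lemma inner_Rn:
  assumes "x \<in> Rn n"
  shows "x \<bullet> y = (\<Sum>i<n. coord x i * coord y i)"
  using assms by (intro inner_fseq_superset) (auto simp: Rn_def not_le[symmetric])


section \<open>Gradient, Hessian and Newton step\<close>

definition gradient :: "('a::real_inner \<Rightarrow> real) \<Rightarrow> 'a \<Rightarrow> 'a" where
  "gradient f p = (THE g. GDERIV f p :> g)"

definition hessian :: "('a::real_inner \<Rightarrow> real) \<Rightarrow> 'a \<Rightarrow> 'a \<Rightarrow> 'a" where
  "hessian f p = frechet_derivative (gradient f) (at p)"

text \<open>
  The Newton step of \<open>f\<close> regarded as a function on the subspace \<open>U\<close>: gradient and Hessian of the
  restriction to \<open>U\<close> are compressions to \<open>U\<close> of the ambient ones, so applying the inverse Hessian
  to the gradient amounts to solving the Newton equation tested against \<open>U\<close>.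
\<close>

definition newton_step :: "'a::real_inner set \<Rightarrow> ('a \<Rightarrow> real) \<Rightarrow> 'a \<Rightarrow> 'a" where
  "newton_step U f p =
     p - (THE d. d \<in> U \<and> (\<forall>v\<in>U. hessian f p d \<bullet> v = gradient f p \<bullet> v))"


section \<open>The scaling problem with shift\<close>

record scaling_instance =
  dimn :: nat                      \<comment> \<open>\<open>n\<close>\<close>
  num :: nat                       \<comment> \<open>\<open>k\<close>\<close>
  expo :: "nat \<Rightarrow> fseq"            \<comment> \<open>\<open>\<omega>\<close>, used for indices below \<open>k\<close> only\<close>
  coef :: "nat \<Rightarrow> real"            \<comment> \<open>\<open>q\<close>, used for indices below \<open>k\<close> only\<close>
  shift :: fseq                    \<comment> \<open>\<open>\<theta>\<close>\<close>
  prec :: real                     \<comment> \<open>\<open>\<epsilon>\<close>\<close>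

definition Omega :: "scaling_instance \<Rightarrow> fseq set" where
  "Omega I = expo I ` {..<num I}"

definition well_conditioned :: "scaling_instance \<Rightarrow> bool" where
  "well_conditioned I \<longleftrightarrow> shift I \<in> rel_interior (convex hull (Omega I))"

definition scaling_input :: "scaling_instance \<Rightarrow> bool" where
  "scaling_input I \<longleftrightarrow> (\<forall>i<num I. expo I i \<in> Rn (dimn I)) \<and> shift I \<in> Rn (dimn I)
     \<and> (\<forall>i<num I. 0 < coef I i) \<and> 0 < prec I"

text \<open>
  \<open>F\<close> and \<open>F_theta\<close> depend on their argument through inner products with vectors of \<open>Rn n\<close> only, so
  their ambient gradients lie in \<open>Rn n\<close> and are the gradients of the restrictions to \<open>Rn n\<close>.
\<close>

definition F :: "scaling_instance \<Rightarrow> fseq \<Rightarrow> real" where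
  "F I x = ln (\<Sum>i<num I. coef I i * exp (expo I i \<bullet> x))"

definition F_theta :: "scaling_instance \<Rightarrow> fseq \<Rightarrow> real" where
  "F_theta I x = F I x - shift I \<bullet> x"

text \<open>
  The supremum is a maximum except if \<open>Omega I = {shift I}\<close>, where the set is unbounded and the
  value is meaningless; \<open>R_theta I\<close> vanishes in that case.
\<close>

definition r_theta :: "scaling_instance \<Rightarrow> real" where
  "r_theta I =
     Sup {r. 0 \<le> r \<and> cball (shift I) r \<inter> affine hull (Omega I) \<subseteq> convex hull (Omega I)}"

definition R_theta :: "scaling_instance \<Rightarrow> real" where
  "R_theta I = Max ((\<lambda>i. norm (expo I i - shift I)) ` {..<num I})"

definition q_norm1 :: "scaling_instance \<Rightarrow> real" where
  "q_norm1 I = (\<Sum>i<num I. \<bar>coef I i\<bar>)"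

definition beta :: "scaling_instance \<Rightarrow> real" where
  "beta I = q_norm1 I / Min (coef I ` {..<num I})"


section \<open>The barrier\<close>

type_synonym point = "fseq \<times> fseq \<times> real"   \<comment> \<open>\<open>(x, z, t)\<close>\<close>

definition W :: "scaling_instance \<Rightarrow> fseq set" where
  "W I = span ((\<lambda>i. expo I i - shift I) ` {..<num I})"

definition point_space :: "scaling_instance \<Rightarrow> point set" where
  "point_space I = W I \<times> Rn (num I) \<times> UNIV"

definition barrier_domain :: "scaling_instance \<Rightarrow> point set" where
  "barrier_domain I = {(x, z, t) \<in> point_space I.
     (\<forall>i<num I. 0 < coord z i) \<and>
     (\<forall>i<num I. 0 < ln (coord z i) - (expo I i - shift I) \<bullet> x + t - ln (coef I i)) \<and>
     0 < ln (5 * real (num I) * q_norm1 I) - t \<and>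
     0 < 1 - (\<Sum>i<num I. coord z i)}"

definition barrier :: "scaling_instance \<Rightarrow> point \<Rightarrow> real" where
  "barrier I = (\<lambda>(x, z, t).
     - (\<Sum>i<num I. ln (coord z i))
     - (\<Sum>i<num I. ln (ln (coord z i) - (expo I i - shift I) \<bullet> x + t - ln (coef I i)))
     - ln (ln (5 * real (num I) * q_norm1 I) - t)
     - ln (1 - (\<Sum>i<num I. coord z i)))"


section \<open>Interior-point algorithms\<close>

text \<open>
  An algorithm is a finite syntactic object, independent of n, k and all other input data. Apart from
  the Newton steps it evaluates a fixed set of closed-form real expressions: rational constants,
  input data, the coordinates of the current iterate, scalar registers, arithmetic, square root,
  exponential, logarithm, comparison, and finite sums over the k exponents or the n coordinates.
  There is no other loop construct, so no iterative work can be done outside the Newton iterations.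
  Index variables come in two sorts, ranging over \<open>{..<k}\<close> and \<open>{..<n}\<close>, so that no data outside the
  instance can be read.
\<close>

datatype expr =
    Const rat
  | DimN
  | NumK
  | Eps
  | Expo nat nat            \<comment> \<open>coordinate \<open>j\<close> of \<open>\<omega>\<^sub>i\<close>\<close>
  | Coef nat
  | Shift nat
  | CurX nat
  | CurZ nat
  | CurT
  | Reg nat
  | Add expr expr
  | Sub expr expr
  | Mul expr expr
  | Div expr expr
  | Sqrt expr
  | Exp expr
  | Ln expr
  | IfLe expr expr expr expr
  | SumK nat expr           \<comment> \<open>sum over \<open>i < k\<close>, binding a \<open>k\<close>-sorted index variable\<close>
  | SumN nat expr           \<comment> \<open>sum over \<open>j < n\<close>, binding an \<open>n\<close>-sorted index variable\<close>

primrec eval_expr ::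
  "scaling_instance \<Rightarrow> point \<Rightarrow> real list \<Rightarrow> expr \<Rightarrow> (nat \<Rightarrow> nat) \<Rightarrow> (nat \<Rightarrow> nat) \<Rightarrow> real"
where
  "eval_expr I p rs (Const c) a b = of_rat c"
| "eval_expr I p rs DimN a b = real (dimn I)"
| "eval_expr I p rs NumK a b = real (num I)"
| "eval_expr I p rs Eps a b = prec I"
| "eval_expr I p rs (Expo i j) a b = coord (expo I (a i)) (b j)"
| "eval_expr I p rs (Coef i) a b = coef I (a i)"
| "eval_expr I p rs (Shift j) a b = coord (shift I) (b j)"
| "eval_expr I p rs (CurX j) a b = coord (fst p) (b j)"
| "eval_expr I p rs (CurZ i) a b = coord (fst (snd p)) (a i)"
| "eval_expr I p rs CurT a b = snd (snd p)"
| "eval_expr I p rs (Reg m) a b = (if m < length rs then rs ! m else 0)"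
| "eval_expr I p rs (Add e f) a b = eval_expr I p rs e a b + eval_expr I p rs f a b"
| "eval_expr I p rs (Sub e f) a b = eval_expr I p rs e a b - eval_expr I p rs f a b"
| "eval_expr I p rs (Mul e f) a b = eval_expr I p rs e a b * eval_expr I p rs f a b"
| "eval_expr I p rs (Div e f) a b = eval_expr I p rs e a b / eval_expr I p rs f a b"
| "eval_expr I p rs (Sqrt e) a b = sqrt (eval_expr I p rs e a b)"
| "eval_expr I p rs (Exp e) a b = exp (eval_expr I p rs e a b)"
| "eval_expr I p rs (Ln e) a b = ln (eval_expr I p rs e a b)"
| "eval_expr I p rs (IfLe e f g h) a b =
     (if eval_expr I p rs e a b \<le> eval_expr I p rs f a b
      then eval_expr I p rs g a b else eval_expr I p rs h a b)"
| "eval_expr I p rs (SumK v e) a b = (\<Sum>i<num I. eval_expr I p rs e (a(v := i)) b)"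
| "eval_expr I p rs (SumN v e) a b = (\<Sum>j<dimn I. eval_expr I p rs e a (b(v := j)))"

text \<open>Unbound index variables denote 0, except in the two kinds of vector-valued expressions, whose
  components are obtained by letting the index variable 0 of the appropriate sort vary.\<close>

definition eval_scalar :: "scaling_instance \<Rightarrow> point \<Rightarrow> real list \<Rightarrow> expr \<Rightarrow> real" where
  "eval_scalar I p rs e = eval_expr I p rs e (\<lambda>_. 0) (\<lambda>_. 0)"

definition eval_point ::
  "scaling_instance \<Rightarrow> point \<Rightarrow> real list \<Rightarrow> expr \<times> expr \<times> expr \<Rightarrow> point" where
  "eval_point I p rs = (\<lambda>(ex, ez, et).
     (vector (dimn I) (\<lambda>j. eval_expr I p rs ex (\<lambda>_. 0) ((\<lambda>_. 0)(0 := j))),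
      vector (num I) (\<lambda>i. eval_expr I p rs ez ((\<lambda>_. 0)(0 := i)) (\<lambda>_. 0)),
      eval_scalar I p rs et))"

record ipm =
  start_point :: "expr \<times> expr \<times> expr"
  start_regs :: "expr list"
  stop_test :: expr                       \<comment> \<open>stop as soon as the value is at most 0\<close>
  linear_part :: "expr \<times> expr \<times> expr"    \<comment> \<open>coefficient vector of the linear function\<close>
  next_regs :: "expr list"

definition objective :: "scaling_instance \<Rightarrow> point \<Rightarrow> point \<Rightarrow> real" where
  "objective I c p = c \<bullet> p + barrier I p"

definition initial :: "ipm \<Rightarrow> scaling_instance \<Rightarrow> point \<times> real list" where
  "initial A I = (eval_point I 0 [] (start_point A), map (eval_scalar I 0 []) (start_regs A))"

definition iteration :: "ipm \<Rightarrow> scaling_instance \<Rightarrow> point \<times> real list \<Rightarrow> point \<times> real list" where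
  "iteration A I = (\<lambda>(p, rs).
     (newton_step (point_space I) (objective I (eval_point I p rs (linear_part A))) p,
      map (eval_scalar I p rs) (next_regs A)))"

definition run :: "ipm \<Rightarrow> scaling_instance \<Rightarrow> nat \<Rightarrow> point \<times> real list" where
  "run A I m = (iteration A I ^^ m) (initial A I)"

definition stopped :: "ipm \<Rightarrow> scaling_instance \<Rightarrow> nat \<Rightarrow> bool" where
  "stopped A I m \<longleftrightarrow> (case run A I m of (p, rs) \<Rightarrow> eval_scalar I p rs (stop_test A) \<le> 0)"

text \<open>On input \<open>I\<close> the algorithm stops after exactly \<open>N\<close> iterations and outputs \<open>x\<close>, and no iterate
  leaves the domain of the barrier, so that every Newton step is meaningful.\<close>

definition returns :: "ipm \<Rightarrow> scaling_instance \<Rightarrow> nat \<Rightarrow> fseq \<Rightarrow> bool" where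
  "returns A I N x \<longleftrightarrow>
     (\<forall>m\<le>N. fst (run A I m) \<in> barrier_domain I) \<and>
     stopped A I N \<and> (\<forall>m<N. \<not> stopped A I m) \<and>
     x = fst (fst (run A I N))"

end

(*
  Path following for Psi with an update of two parameters: the linear term is
  - tau * grad Psi (p0) + eta * t. The starting point p0 is the exact center for (tau, eta) = (1, 0);
  the first phase shrinks tau geometrically, the second one drops tau and lets eta grow geometrically.
  As r_theta cannot be computed by closed-form expressions, the phases are switched by a computable
  bound kappa (p) on the local dual norm of grad Psi (p0); it is at most polynomial in k, R_theta / r_theta
  and log (k beta) on the whole domain, so the switch happens soon enough.

  No general theory of self-concordance is needed. In coordinates relative to the logarithms' arguments
  the error of a Newton step on a single exponential cone is an explicit rational expression, which
  gives directly that the Newton decrement is squared up to a factor 5. Concavity of the arguments of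
  the logarithms bounds t (p) - F_theta (x') by O (k) / eta for every x', and the choice of x' as a
  gradient step from x turns this into a bound on the norm of the gradient, which is also the stopping
  criterion.
*)

theory Submission
  imports Defs
begin

section \<open>Real inequalities\<close>

text \<open>Path following has to start near a center, and no center for the objective
  \<open>\<eta> * t\<close> is known in closed form; the auxiliary linear term turns an explicit
  point into one. How fast that term can be removed depends on the size of the domain, and this is
  where well-conditioning enters: a ball of radius \<open>r_theta I\<close> around the shift, within
  the affine hull, bounds x and with it every slack, and only the logarithm of the bound is paid
  for.

  One budget runs through all estimates. An iterate has Newton decrement at most 1/80, a parameter
  change adds at most 3/80, and a Newton step from 1/20 gives 5 * (1/20)^2 = 1/80 again. Decrements
  are expressed by pairing with test vectors of \<open>U\<close>, and the residual after a step is
  measured in the local norm of the new point, so that the new decrement is read off without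
  inverting a Hessian.

  Derivatives are taken in the ambient space, which is infinite-dimensional; only the Newton
  equation is restricted to \<open>U\<close>.\<close>

lemma sub_ln_one_plus_lower:
  fixes \<alpha> :: real
  assumes "-1 < \<alpha>"
  shows "\<alpha>\<^sup>2 \<le> 2 * (2 + \<alpha>) * (\<alpha> - ln (1 + \<alpha>))"
proof -
  \<comment> \<open>With \<open>1 + \<alpha> = w\<^sup>2\<close> the logarithm is
    \<open>2 * ln w\<close>, and \<open>ln w \<le> w - 1\<close> leaves
    \<open>(w - 1)\<^sup>2\<close> below the right-hand defect. The other factor of
    \<open>\<alpha>\<^sup>2\<close> is \<open>(w + 1)\<^sup>2\<close>, at most
    \<open>2 * (w\<^sup>2 + 1)\<close>.\<close>
  define w where "w = sqrt (1 + \<alpha>)"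
  have w: "0 < w" "\<alpha> = w\<^sup>2 - 1" using assms by (auto simp: w_def)
  have "ln (1 + \<alpha>) = 2 * ln w" using w by (simp add: ln_realpow)
  also have "\<dots> \<le> 2 * (w - 1)" using ln_le_minus_one[of w] w by simp
  finally have low: "(w - 1)\<^sup>2 \<le> \<alpha> - ln (1 + \<alpha>)"
    by (simp add: w(2) power2_eq_square algebra_simps)
  have "\<alpha>\<^sup>2 = (w + 1)\<^sup>2 * (w - 1)\<^sup>2" by (simp add: w(2) power2_eq_square algebra_simps)
  also have "\<dots> \<le> (2 * (2 + \<alpha>)) * (w - 1)\<^sup>2"
  proof (rule mult_right_mono)
    have "0 \<le> (w - 1)\<^sup>2" by simp
    then show "(w + 1)\<^sup>2 \<le> 2 * (2 + \<alpha>)" by (simp add: w(2) power2_eq_square algebra_simps)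
  qed simp
  also have "\<dots> \<le> 2 * (2 + \<alpha>) * (\<alpha> - ln (1 + \<alpha>))"
    using low assms by (intro mult_left_mono) auto
  finally show ?thesis .
qed

lemma sub_ln_one_plus_nonneg:
  fixes \<alpha> :: real
  assumes "-1 < \<alpha>"
  shows "0 \<le> \<alpha> - ln (1 + \<alpha>)"
  using ln_le_minus_one[of "1 + \<alpha>"] assms by simp

text \<open>\<open>s\<close> and \<open>s'\<close> are the slack before and after a step of relative
  size \<open>\<alpha>\<close> in z and \<open>u\<close> in the linearized slack;
  \<open>\<alpha> - ln (1 + \<alpha>)\<close> is what the concavity of ln takes off the linear
  prediction. For a step of squared local norm at most 1/400 = (1/20)^2 this loss is too small to
  reach the boundary.\<close>

lemma cone_local_bounds:
  fixes \<alpha> u s :: real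
  defines "s' \<equiv> s * (1 + u) - (\<alpha> - ln (1 + \<alpha>))"
  assumes s: "0 < s" and small: "\<alpha>\<^sup>2 + u\<^sup>2 + \<alpha>\<^sup>2 / s \<le> 1 / 400"
  shows "\<bar>\<alpha>\<bar> \<le> 1 / 20" "\<bar>u\<bar> \<le> 1 / 20"
    "(\<alpha> - ln (1 + \<alpha>)) / s \<le> 2 * (\<alpha>\<^sup>2 / s)" "0 \<le> (\<alpha> - ln (1 + \<alpha>)) / s"
    "0 < 1 + \<alpha>" "0 < s'" "s' \<le> 2 * s"
proof -
  have nn: "0 \<le> \<alpha>\<^sup>2 / s" "0 \<le> \<alpha>\<^sup>2" "0 \<le> u\<^sup>2" using s by auto
  have "\<alpha>\<^sup>2 \<le> 1 / 400" "u\<^sup>2 \<le> 1 / 400" using nn small by linarith+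
  then have "\<alpha>\<^sup>2 \<le> (1 / 20)\<^sup>2" "u\<^sup>2 \<le> (1 / 20)\<^sup>2" by (simp_all add: power_divide)
  then show a: "\<bar>\<alpha>\<bar> \<le> 1 / 20" and u: "\<bar>u\<bar> \<le> 1 / 20"
    using abs_le_square_iff[of \<alpha> "1/20"] abs_le_square_iff[of u "1/20"] by auto
  have up: "\<alpha> - ln (1 + \<alpha>) \<le> 2 * \<alpha>\<^sup>2"
    using abs_ln_one_plus_x_minus_x_bound[of \<alpha>] a by (auto simp: abs_le_iff)
  then show k: "(\<alpha> - ln (1 + \<alpha>)) / s \<le> 2 * (\<alpha>\<^sup>2 / s)"
    using s divide_right_mono[of "\<alpha> - ln (1 + \<alpha>)" "2 * \<alpha>\<^sup>2" s] by simp
  show "0 < 1 + \<alpha>" using a by auto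
  then have nn2: "0 \<le> \<alpha> - ln (1 + \<alpha>)" using sub_ln_one_plus_nonneg[of \<alpha>] by simp
  then show "0 \<le> (\<alpha> - ln (1 + \<alpha>)) / s" using s by simp
  have eq: "s' = s * (1 + u - (\<alpha> - ln (1 + \<alpha>)) / s)" using s by (simp add: s'_def field_simps)
  have "(\<alpha> - ln (1 + \<alpha>)) / s \<le> 1 / 200" using k small nn by linarith
  then have "0 < 1 + u - (\<alpha> - ln (1 + \<alpha>)) / s" using u by linarith
  then show "0 < s'" unfolding eq using s by (intro mult_pos_pos)
  have "0 \<le> (\<alpha> - ln (1 + \<alpha>)) / s" using nn2 s by simp
  then have "1 + u - (\<alpha> - ln (1 + \<alpha>)) / s \<le> 2" using abs_le_D1[OF u] by linarith
  then show "s' \<le> 2 * s" unfolding eq using s by (simp add: mult.commute mult_left_mono)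
qed

text \<open>The difference of the gradients of \<open>- ln z - ln (ln z - y)\<close> at two points, less the Hessian
  term. Here \<open>\<alpha>\<close>, \<open>u\<close> are the step relative to the old point, \<open>\<nu>\<close>, \<open>\<theta>\<close> the test direction
  relative to the new one, \<open>(1 + \<alpha>) * \<nu>\<close> and \<open>((1 + \<alpha>) * \<nu> - (\<nu> - s' * \<theta>)) / s\<close> the same test
  direction relative to the old one.\<close>

lemma cone_newton_remainder:
  fixes \<alpha> u s \<nu> \<theta> :: real
  defines "s' \<equiv> s * (1 + u) - (\<alpha> - ln (1 + \<alpha>))"
  defines "\<theta>0 \<equiv> ((1 + \<alpha>) * \<nu> - (\<nu> - s' * \<theta>)) / s"
  defines "l \<equiv> \<alpha>\<^sup>2 + u\<^sup>2 + \<alpha>\<^sup>2 / s"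
  assumes s: "0 < s" and small: "l \<le> 1 / 400"
  shows "\<bar>- (\<nu> + \<theta>) + ((1 + \<alpha>) * \<nu> + \<theta>0)
            - (\<alpha> * ((1 + \<alpha>) * \<nu>) + u * \<theta>0 + \<alpha> * ((1 + \<alpha>) * \<nu>) / s)\<bar>
         \<le> 5 * l * sqrt (\<nu>\<^sup>2 + \<theta>\<^sup>2 + \<nu>\<^sup>2 / s')"
proof -
  \<comment> \<open>The relative loss of slack caused by the curvature of ln. In terms of it the
    remainder becomes a sum in which every term is of second order in the step.\<close>
  define \<kappa> where "\<kappa> = (\<alpha> - ln (1 + \<alpha>)) / s"
  define N where "N = sqrt (\<nu>\<^sup>2 + \<theta>\<^sup>2 + \<nu>\<^sup>2 / s')"
  note b = cone_local_bounds[OF s small[unfolded l_def], folded \<kappa>_def s'_def]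
  have s'k: "s' = s * (1 + u - \<kappa>)" using s by (simp add: s'_def \<kappa>_def field_simps)
  have nn: "0 \<le> \<alpha>\<^sup>2 / s" "0 \<le> \<alpha>\<^sup>2" "0 \<le> u\<^sup>2" using s by auto
  then have l0: "0 \<le> l" by (simp add: l_def)
  have th0: "\<theta>0 = (1 + u - \<kappa>) * \<theta> + \<alpha> * \<nu> / s"
    using s by (simp add: \<theta>0_def s'k field_simps)
  have "- (\<nu> + \<theta>) + ((1 + \<alpha>) * \<nu> + \<theta>0)
            - (\<alpha> * ((1 + \<alpha>) * \<nu>) + u * \<theta>0 + \<alpha> * ((1 + \<alpha>) * \<nu>) / s)
        = - (\<alpha>\<^sup>2 * \<nu>) - (u\<^sup>2 + \<kappa> * (1 - u)) * \<theta> - (\<alpha> / s) * (u + \<alpha>) * \<nu>"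
    using s unfolding th0 by (simp add: field_simps power2_eq_square)
  also have "\<bar>\<dots>\<bar> \<le> \<alpha>\<^sup>2 * \<bar>\<nu>\<bar> + (u\<^sup>2 + \<kappa> * (1 - u)) * \<bar>\<theta>\<bar> + \<bar>(\<alpha> / s) * (u + \<alpha>) * \<nu>\<bar>"
  proof -
    have "0 \<le> u\<^sup>2 + \<kappa> * (1 - u)" using b by auto
    then show ?thesis
      using nn(2) abs_triangle_ineq4[of "- (\<alpha>\<^sup>2 * \<nu>) - (u\<^sup>2 + \<kappa> * (1 - u)) * \<theta>" "(\<alpha> / s) * (u + \<alpha>) * \<nu>"]
        abs_triangle_ineq4[of "- (\<alpha>\<^sup>2 * \<nu>)" "(u\<^sup>2 + \<kappa> * (1 - u)) * \<theta>"]
      by (simp add: abs_mult)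
  qed
  also have "\<dots> \<le> \<alpha>\<^sup>2 * N + (u\<^sup>2 + 3 * (\<alpha>\<^sup>2 / s)) * N + 2 * l * N"
  proof -
    have n0: "0 \<le> \<nu>\<^sup>2 / s'" using b by auto
    have N0: "0 \<le> N" using n0 by (simp add: N_def)
    have nN: "\<bar>\<nu>\<bar> \<le> N" and tN: "\<bar>\<theta>\<bar> \<le> N"
      unfolding N_def using n0 by (auto intro!: real_le_rsqrt)
    have vN: "\<bar>\<nu>\<bar> / sqrt s' \<le> N"
      unfolding N_def using b n0 by (intro real_le_rsqrt) (auto simp: power_divide)
    have "\<kappa> * (1 - u) \<le> (2 * (\<alpha>\<^sup>2 / s)) * (3/2)" using b nn by (intro mult_mono) auto
    then have k: "\<kappa> * (1 - u) \<le> 3 * (\<alpha>\<^sup>2 / s)" by simp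
    \<comment> \<open>The mixed term carries a full factor \<open>1 / s\<close>. Half of it,
      \<open>1 / sqrt s\<close>, goes with \<open>\<alpha>\<close> into \<open>g\<close>, a part of
      the step's norm; the other half goes with \<open>\<nu>\<close> and is converted to
      \<open>1 / sqrt s'\<close> by \<open>s' \<le> 2 * s\<close>.\<close>
    define g where "g = \<bar>\<alpha>\<bar> / sqrt s"
    have g2: "g\<^sup>2 = \<alpha>\<^sup>2 / s" using s by (simp add: g_def power_divide)
    have g0: "0 \<le> g" using s by (simp add: g_def)
    have "sqrt s' \<le> sqrt (2 * s)" using b by simp
    also have "\<dots> \<le> sqrt (4 * s)" using s by simp
    also have "\<dots> = 2 * sqrt s" by (simp add: real_sqrt_mult)
    finally have rt: "sqrt s' \<le> 2 * sqrt s" .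
    have "\<bar>(\<alpha> / s) * (u + \<alpha>) * \<nu>\<bar> = (g / sqrt s) * \<bar>u + \<alpha>\<bar> * ((\<bar>\<nu>\<bar> / sqrt s') * sqrt s')"
      using s b by (simp add: g_def abs_mult)
    also have "\<dots> \<le> (g / sqrt s) * (\<bar>u\<bar> + \<bar>\<alpha>\<bar>) * (N * (2 * sqrt s))"
      using vN rt s g0 b by (intro mult_mono) (auto simp: N_def intro!: mult_nonneg_nonneg)
    also have "\<dots> = 2 * (g * \<bar>u\<bar> + g * \<bar>\<alpha>\<bar>) * N" using s by (simp add: field_simps)
    also have "\<dots> \<le> 2 * l * N"
    proof -
      have "0 \<le> (g - \<bar>u\<bar>)\<^sup>2" "0 \<le> (g - \<bar>\<alpha>\<bar>)\<^sup>2" by auto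
      then have "2 * (g * \<bar>u\<bar> + g * \<bar>\<alpha>\<bar>) \<le> 2 * g\<^sup>2 + u\<^sup>2 + \<alpha>\<^sup>2"
        by (simp add: power2_diff algebra_simps)
      also have "\<dots> \<le> 2 * l" unfolding l_def g2 using nn by simp
      finally show ?thesis by (intro mult_right_mono) (auto simp: N_def n0)
    qed
    finally have 3: "\<bar>(\<alpha> / s) * (u + \<alpha>) * \<nu>\<bar> \<le> 2 * l * N" .
    have 1: "\<alpha>\<^sup>2 * \<bar>\<nu>\<bar> \<le> \<alpha>\<^sup>2 * N" using nN by (intro mult_left_mono) auto
    have 2: "(u\<^sup>2 + \<kappa> * (1 - u)) * \<bar>\<theta>\<bar> \<le> (u\<^sup>2 + 3 * (\<alpha>\<^sup>2 / s)) * N"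
      using tN k nn by (intro mult_mono[OF add_left_mono]) auto
    show ?thesis using 1 2 3 by linarith
  qed
  also have "\<dots> \<le> 5 * l * N"
  proof -
    have "\<alpha>\<^sup>2 + (u\<^sup>2 + 3 * (\<alpha>\<^sup>2 / s)) + 2 * l \<le> 5 * l" using nn by (simp add: l_def)
    then have "(\<alpha>\<^sup>2 + (u\<^sup>2 + 3 * (\<alpha>\<^sup>2 / s)) + 2 * l) * N \<le> 5 * l * N"
      using b by (intro mult_right_mono) (auto simp: N_def)
    then show ?thesis by (simp add: algebra_simps)
  qed
  finally show ?thesis by (simp add: N_def)
qed

text \<open>For steps of any length inside the domain: positivity of the new slack bounds the
  concavity loss by \<open>s * (1 + u)\<close>, and \<open>sub_ln_one_plus_lower\<close> turns this
  into a bound on \<open>\<alpha>\<^sup>2 / s\<close>. The local norm is thus at most linear in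
  \<open>1 + \<alpha>\<close> and \<open>1 + u\<close>, whose sums occur in the pairing of the
  barrier's gradient with the step.\<close>

lemma cone_far_bound:
  fixes \<alpha> u s :: real
  assumes s: "0 < s" and a: "-1 < \<alpha>" and pos: "0 < s * (1 + u) - (\<alpha> - ln (1 + \<alpha>))"
  shows "-1 < u" "sqrt (\<alpha>\<^sup>2 + u\<^sup>2 + \<alpha>\<^sup>2 / s) \<le> 2 * (1 + \<alpha>) + 2 * (1 + u) + 3"
proof -
  have n: "0 \<le> \<alpha> - ln (1 + \<alpha>)" using sub_ln_one_plus_nonneg[OF a] .
  then have "0 < s * (1 + u)" using pos by linarith
  then show u: "-1 < u" using s by (simp add: zero_less_mult_iff)
  have "\<alpha>\<^sup>2 \<le> 2 * (2 + \<alpha>) * (\<alpha> - ln (1 + \<alpha>))" by (rule sub_ln_one_plus_lower[OF a])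
  also have "\<dots> \<le> 2 * (2 + \<alpha>) * (s * (1 + u))" using a pos by (intro mult_left_mono) auto
  finally have "\<alpha>\<^sup>2 / s \<le> 2 * (2 + \<alpha>) * (1 + u)" using s by (simp add: field_simps)
  also have "\<dots> \<le> ((2 + \<alpha>) + (1 + u))\<^sup>2"
    using zero_le_power2[of "2 + \<alpha>"] zero_le_power2[of "1 + u"]
      power2_sum[of "2 + \<alpha>" "1 + u"] by linarith
  finally have 3: "sqrt (\<alpha>\<^sup>2 / s) \<le> (2 + \<alpha>) + (1 + u)" using a u by (intro real_le_lsqrt) auto
  have "sqrt (\<alpha>\<^sup>2 + u\<^sup>2 + \<alpha>\<^sup>2 / s) \<le> sqrt (\<alpha>\<^sup>2 + u\<^sup>2) + sqrt (\<alpha>\<^sup>2 / s)"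
    using s by (intro sqrt_add_le_add_sqrt) auto
  also have "\<dots> \<le> \<bar>\<alpha>\<bar> + \<bar>u\<bar> + sqrt (\<alpha>\<^sup>2 / s)"
    using sqrt_add_le_add_sqrt[of "\<alpha>\<^sup>2" "u\<^sup>2"] by simp
  also have "\<dots> \<le> (2 + \<alpha>) + (2 + u) + ((2 + \<alpha>) + (1 + u))"
    using 3 a u by (intro add_mono) (auto simp: abs_le_iff)
  finally show "sqrt (\<alpha>\<^sup>2 + u\<^sup>2 + \<alpha>\<^sup>2 / s) \<le> 2 * (1 + \<alpha>) + 2 * (1 + u) + 3"
    by simp
qed

lemma exp_le_quadratic:
  fixes u :: real
  assumes "\<bar>u\<bar> \<le> 1"
  shows "exp u \<le> 1 + u + u\<^sup>2"
proof (cases "0 \<le> u")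
  case True
  then show ?thesis using exp_bound[of u] assms by simp
next
  case False
  define w where "w = - u"
  have w: "0 \<le> w" "w \<le> 1" using False assms by (auto simp: w_def)
  have "1 \<le> (1 + w) * (1 - w + w\<^sup>2)"
    using w by (simp add: power2_eq_square algebra_simps)
  also have "\<dots> \<le> exp w * (1 - w + w\<^sup>2)"
    using exp_ge_add_one_self[of w] w by (intro mult_right_mono) auto
  finally have "exp (- w) \<le> 1 - w + w\<^sup>2"
    by (simp add: exp_minus field_simps)
  then show ?thesis by (simp add: w_def)
qed

lemma sqrt_sum_le:
  assumes "finite A" "\<And>i. i \<in> A \<Longrightarrow> 0 \<le> f i"
  shows "sqrt (\<Sum>i\<in>A. f i) \<le> (\<Sum>i\<in>A. sqrt (f i))"
  using assms
proof (induction A rule: finite_induct)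
  case (insert x A)
  then have "sqrt (f x + sum f A) \<le> sqrt (f x) + sqrt (sum f A)"
    by (intro sqrt_add_le_add_sqrt sum_nonneg) auto
  with insert show ?case by force
qed simp

section \<open>Linear equations for positive definite forms\<close>

text \<open>Gram-Schmidt along the generators: subtracting from \<open>b\<close> its B-projection
  \<open>e\<close> on the old span gives \<open>c\<close> orthogonal to that span, and the solution
  on the old span is corrected by a multiple of \<open>c\<close>. Working with a span avoids a basis
  and any dimension of the ambient type.\<close>

lemma pos_def_solve:
  fixes B :: "'a::real_vector \<Rightarrow> 'a \<Rightarrow> real"
  assumes "finite S"
    and lin: "\<And>v. linear (\<lambda>w. B v w)"
    and sym: "\<And>v w. B v w = B w v"
    and pos: "\<And>v. v \<in> span S \<Longrightarrow> v \<noteq> 0 \<Longrightarrow> 0 < B v v"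
    and l: "linear l"
  shows "\<exists>!d. d \<in> span S \<and> (\<forall>v\<in>span S. B d v = l v)"
proof -
  have B0: "B v 0 = 0" for v using linear_0[OF lin] .
  have Badd: "B v (w + w') = B v w + B v w'" for v w w' using linear_add[OF lin] .
  have Bdiff: "B v (w - w') = B v w - B v w'" for v w w' using linear_diff[OF lin] .
  have Bsc: "B v (c *\<^sub>R w) = c * B v w" for v w c using linear_scale[OF lin] by simp
  have "\<exists>d. d \<in> span S \<and> (\<forall>v\<in>span S. B d v = l v)"
    using assms(1) pos l
  proof (induction S arbitrary: l)
    case empty
    then show ?case by (auto simp: B0 linear_0)
  next
    case (insert b S)
    have pos': "v \<in> span S \<Longrightarrow> v \<noteq> 0 \<Longrightarrow> 0 < B v v" for v
      using insert.prems(1) span_mono[of S "insert b S"] by blast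
    obtain e where e: "e \<in> span S" "\<And>v. v \<in> span S \<Longrightarrow> B e v = B b v"
      using insert.IH[OF pos' lin[of b]] by blast
    obtain d where d: "d \<in> span S" "\<And>v. v \<in> span S \<Longrightarrow> B d v = l v"
      using insert.IH[OF pos' insert.prems(2)] by blast
    define c where "c = b - e"
    have c: "c \<in> span (insert b S)" unfolding c_def using e(1)
      by (meson span_base span_diff insertI1 span_mono subset_insertI subsetD)
    have orth: "B c v = 0" if "v \<in> span S" for v
      using e(2)[OF that] sym[of c v] sym[of v e] sym[of v b] by (simp add: c_def Bdiff)
    have span: "\<exists>\<gamma> w. v = \<gamma> *\<^sub>R c + w \<and> w \<in> span S" if v: "v \<in> span (insert b S)" for v
    proof -
      obtain \<gamma> where g: "v - \<gamma> *\<^sub>R b \<in> span S"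
        using v unfolding span_insert by blast
      have "(v - \<gamma> *\<^sub>R b) + \<gamma> *\<^sub>R e \<in> span S" by (intro span_add g span_scale e)
      moreover have "v = \<gamma> *\<^sub>R c + ((v - \<gamma> *\<^sub>R b) + \<gamma> *\<^sub>R e)" by (simp add: c_def algebra_simps)
      ultimately show ?thesis by blast
    qed
    define f where "f = d + (l c / B c c) *\<^sub>R c"
    have "f \<in> span (insert b S)" unfolding f_def
      using d(1) c by (meson span_add span_scale span_mono subset_insertI subsetD)
    moreover have "B f v = l v" if v: "v \<in> span (insert b S)" for v
    proof -
      obtain \<gamma> w where w: "v = \<gamma> *\<^sub>R c + w" "w \<in> span S" using span[OF v] by blast
      have "B d c = 0" using orth[OF d(1)] sym by metis
      then have 1: "B v f = \<gamma> * (l c / B c c) * B c c + l w"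
        using orth[OF w(2)] orth[OF d(1)] d(2)[OF w(2)]
        by (simp add: f_def w(1) Badd Bsc sym[of "_ + _"] sym[of _ d] sym[of w c])
      \<comment> \<open>If \<open>b\<close> depends on the earlier generators, then
        \<open>c = 0\<close>, and the division by zero is harmless because \<open>l c\<close> is 0
        as well.\<close>
      have 2: "l c / B c c * B c c = l c"
      proof (cases "c = 0")
        case True then show ?thesis using insert.prems(2) by (simp add: linear_0)
      next
        case False then show ?thesis using insert.prems(1)[OF c] by auto
      qed
      have "l v = \<gamma> * l c + l w"
        using insert.prems(2) by (simp add: w(1) linear_add linear_scale)
      then show ?thesis
        using 1 unfolding mult.assoc 2 sym[of v f] by simp
    qed
    ultimately show ?case by blast
  qed
  moreover have "d = d'" if "d \<in> span S \<and> (\<forall>v\<in>span S. B d v = l v)"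
    "d' \<in> span S \<and> (\<forall>v\<in>span S. B d' v = l v)" for d d'
  proof (rule ccontr)
    assume "d \<noteq> d'"
    have m: "d - d' \<in> span S" using that by (simp add: span_diff)
    then have "0 < B (d - d') (d - d')" using \<open>d \<noteq> d'\<close> by (intro pos) auto
    moreover have "B d (d - d') = B d' (d - d')" using that m by auto
    then have "B (d - d') (d - d') = 0" by (simp add: Bdiff sym[of "d - d'"])
    ultimately show False by simp
  qed
  ultimately show ?thesis by blast
qed

section \<open>The inner product space of finite sequences\<close>

lemma coord_vector [simp]: "coord (vector n f) i = (if i < n then f i else 0)"
  by (simp add: vector.rep_eq)

lemma vector_in_Rn [simp]: "vector n f \<in> Rn n"
  by (simp add: Rn_def)

lemma vector_coord: "x \<in> Rn n \<Longrightarrow> (\<And>i. i < n \<Longrightarrow> f i = coord x i) \<Longrightarrow> vector n f = x"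
  by (rule fseq_eqI) (auto simp: Rn_def)

lemma inner_vector: "vector n f \<bullet> y = (\<Sum>i<n. f i * coord y i)"
  by (subst inner_Rn[of _ n]) auto

lemma coord_sum: "coord (\<Sum>i\<in>A. f i) j = (\<Sum>i\<in>A. coord (f i) j)"
  by (induction A rule: infinite_finite_induct) (auto simp: coord_arith)

definition unit_fseq :: "nat \<Rightarrow> fseq" where
  "unit_fseq i = vector (Suc i) (\<lambda>j. if j = i then 1 else 0)"

lemma coord_unit [simp]: "coord (unit_fseq i) j = (if j = i then 1 else 0)"
  by (auto simp: unit_fseq_def)

lemma unit_inner [simp]: "unit_fseq i \<bullet> x = coord x i"
  by (simp add: unit_fseq_def inner_vector lessThan_Suc)

lemma subspace_Rn: "subspace (Rn n)"
  by (auto simp: subspace_def Rn_def coord_arith)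

lemma Rn_span: "Rn n = span (unit_fseq ` {..<n})"
proof
  show "span (unit_fseq ` {..<n}) \<subseteq> Rn n"
    by (rule span_minimal[OF _ subspace_Rn]) (auto simp: Rn_def)
  show "Rn n \<subseteq> span (unit_fseq ` {..<n})"
  proof
    fix x assume "x \<in> Rn n"
    then have "x = (\<Sum>i<n. coord x i *\<^sub>R unit_fseq i)"
      by (intro fseq_eqI) (auto simp: Rn_def coord_sum coord_arith if_distrib cong: if_cong)
    also have "\<dots> \<in> span (unit_fseq ` {..<n})"
      by (intro span_sum span_scale span_base) auto
    finally show "x \<in> span (unit_fseq ` {..<n})" .
  qed
qed

lemma bounded_linear_coord: "bounded_linear (\<lambda>x. coord x i)"
  using bounded_linear_inner_right[of "unit_fseq i"] by simp

lemmas has_derivative_coord [derivative_intros] =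
  bounded_linear.has_derivative[OF bounded_linear_coord]

lemma span_Times:
  "span A \<times> span B = span ((\<lambda>a. (a, 0)) ` A \<union> (\<lambda>b. (0, b)) ` B)" (is "_ = span (?L \<union> ?R)")
proof
  have lin: "linear (\<lambda>a::'a. (a, 0::'b))" "linear (\<lambda>b::'b. (0::'a, b))"
    by (auto intro!: linearI)
  show "span A \<times> span B \<subseteq> span (?L \<union> ?R)"
  proof clarify
    fix a b assume "a \<in> span A" "b \<in> span B"
    then have "(a, 0) \<in> span ?L" "(0, b) \<in> span ?R"
      using linear_span_image[OF lin(1), of A] linear_span_image[OF lin(2), of B] by auto
    then have "(a, 0) + (0, b) \<in> span (?L \<union> ?R)"
      by (meson span_add span_mono sup_ge1 sup_ge2 subsetD)
    then show "(a, b) \<in> span (?L \<union> ?R)" by simp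
  qed
  show "span (?L \<union> ?R) \<subseteq> span A \<times> span B"
  proof (rule span_minimal)
    show "subspace (span A \<times> span B)" by (simp add: subspace_Times)
  qed (auto simp: span_base span_0)
qed

section \<open>Derivatives of the barrier\<close>

lemma gradient_eqI:
  assumes "GDERIV f p :> g"
  shows "gradient f p = g"
  unfolding gradient_def
proof (rule the_equality)
  fix g' assume "GDERIV f p :> g'"
  then have "(\<lambda>h. h \<bullet> g') = (\<lambda>h. h \<bullet> g)"
    using assms has_derivative_unique unfolding gderiv_def by blast
  then have "(g' - g) \<bullet> g' = (g' - g) \<bullet> g" by meson
  then have "(g' - g) \<bullet> (g' - g) = 0" by (simp add: inner_diff_right)
  then show "g' = g" by simp
qed (use assms in auto)

locale scaling =
  fixes I :: scaling_instance
  assumes input: "scaling_input I" and wc: "well_conditioned I"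
begin

abbreviation "k \<equiv> num I"
abbreviation "a i \<equiv> expo I i - shift I"
abbreviation "q \<equiv> coef I"
abbreviation "tmax \<equiv> ln (5 * real k * q_norm1 I)"
abbreviation "xc \<equiv> (fst :: point \<Rightarrow> fseq)"
abbreviation "zc p i \<equiv> coord (fst (snd (p :: point))) i"
abbreviation "tc p \<equiv> snd (snd (p :: point))"
abbreviation "U \<equiv> point_space I"

definition slack :: "nat \<Rightarrow> point \<Rightarrow> real" where
  "slack i p = ln (zc p i) - a i \<bullet> xc p + tc p - ln (q i)"

definition rest :: "point \<Rightarrow> real" where
  "rest p = 1 - (\<Sum>i<k. zc p i)"

text \<open>Kept apart from membership in \<open>U\<close>: these inequalities define an open set of
  the ambient space, on which ambient derivatives exist.\<close>

definition pos :: "point \<Rightarrow> bool" where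
  "pos p \<longleftrightarrow> (\<forall>i<k. 0 < zc p i) \<and> (\<forall>i<k. 0 < slack i p) \<and> 0 < tmax - tc p \<and> 0 < rest p"

lemma domain_eq: "barrier_domain I = {p \<in> U. pos p}"
  by (auto simp: barrier_domain_def pos_def slack_def rest_def)

lemma barrier_eq:
  "barrier I p = - (\<Sum>i<k. ln (zc p i)) - (\<Sum>i<k. ln (slack i p)) - ln (tmax - tc p) - ln (rest p)"
  by (simp add: barrier_def slack_def rest_def split_beta)

text \<open>The derivatives, in a direction \<open>v\<close>, of the logarithms of the arguments of the barrier.\<close>

definition relz :: "point \<Rightarrow> point \<Rightarrow> nat \<Rightarrow> real" where
  "relz p v i = zc v i / zc p i"

definition rels :: "point \<Rightarrow> point \<Rightarrow> nat \<Rightarrow> real" where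
  "rels p v i = (relz p v i - a i \<bullet> xc v + tc v) / slack i p"

definition relt :: "point \<Rightarrow> point \<Rightarrow> real" where
  "relt p v = - tc v / (tmax - tc p)"

definition relr :: "point \<Rightarrow> point \<Rightarrow> real" where
  "relr p v = - (\<Sum>i<k. zc v i) / rest p"

definition bgrad :: "point \<Rightarrow> point" where
  "bgrad p = (\<Sum>i<k. (1 / slack i p) *\<^sub>R a i,
     \<Sum>i<k. (1 / rest p - (1 + 1 / slack i p) / zc p i) *\<^sub>R unit_fseq i,
     1 / (tmax - tc p) - (\<Sum>i<k. 1 / slack i p))"

definition bhess :: "point \<Rightarrow> point \<Rightarrow> point" where
  "bhess p d = (\<Sum>i<k. (- (rels p d i / slack i p)) *\<^sub>R a i,
     \<Sum>i<k. (- relr p d / rest p + (rels p d i / slack i p + (1 + 1 / slack i p) * relz p d i) / zc p i)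
        *\<^sub>R unit_fseq i,
     - relt p d / (tmax - tc p) + (\<Sum>i<k. rels p d i / slack i p))"

text \<open>The second derivative of \<open>- ln f\<close> is the product of the logarithmic
  derivatives of \<open>f\<close> minus \<open>D^2 f / f\<close>. Only the slack is a curved
  argument; its second derivative is minus the product of the two \<open>relz\<close>, which yields
  the term divided by \<open>slack i p\<close>.\<close>

definition hform :: "point \<Rightarrow> point \<Rightarrow> point \<Rightarrow> real" where
  "hform p v w = (\<Sum>i<k. relz p v i * relz p w i + rels p v i * rels p w i
       + relz p v i * relz p w i / slack i p)
     + relt p v * relt p w + relr p v * relr p w"

lemma bgrad_inner:
  assumes "pos p"
  shows "bgrad p \<bullet> v = - ((\<Sum>i<k. relz p v i + rels p v i) + relt p v + relr p v)"
proof -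
  have "bgrad p \<bullet> v = (\<Sum>i<k. (1 / slack i p) * (a i \<bullet> xc v))
     + (\<Sum>i<k. (1 / rest p - (1 + 1 / slack i p) / zc p i) * zc v i)
     + (1 / (tmax - tc p) - (\<Sum>i<k. 1 / slack i p)) * tc v"
    by (simp add: bgrad_def inner_prod_def inner_sum_left)
  also have "\<dots> = (\<Sum>i<k. (1 / slack i p) * (a i \<bullet> xc v)
      + (1 / rest p - (1 + 1 / slack i p) / zc p i) * zc v i - 1 / slack i p * tc v)
     + tc v / (tmax - tc p)"
    by (simp add: sum.distrib sum_subtractf sum_distrib_right left_diff_distrib)
  also have "\<dots> = (\<Sum>i<k. - (relz p v i + rels p v i) + zc v i / rest p) + tc v / (tmax - tc p)"
  proof -
    have "(1 / s) * x + (1 / r - (1 + 1 / s) / z) * vz - 1 / s * t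
        = - (vz / z + (vz / z - x + t) / s) + vz / r" if "0 < s" "0 < z" "0 < r" for s z r x vz t :: real
      using that by (simp add: field_simps)
    then show ?thesis
      using assms by (simp add: relz_def rels_def pos_def)
  qed
  finally show ?thesis
    by (simp add: sum.distrib sum_negf sum_subtractf sum_divide_distrib relt_def relr_def)
qed

lemma bhess_inner:
  assumes "pos p"
  shows "bhess p d \<bullet> v = hform p d v"
proof -
  have "bhess p d \<bullet> v = (\<Sum>i<k. (- (rels p d i / slack i p)) * (a i \<bullet> xc v))
     + (\<Sum>i<k. (- relr p d / rest p
          + (rels p d i / slack i p + (1 + 1 / slack i p) * relz p d i) / zc p i) * zc v i)
     + (- relt p d / (tmax - tc p) + (\<Sum>i<k. rels p d i / slack i p)) * tc v"
    by (simp add: bhess_def inner_prod_def inner_sum_left)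
  also have "\<dots> = (\<Sum>i<k. (- (rels p d i / slack i p)) * (a i \<bullet> xc v)
      + (- relr p d / rest p
          + (rels p d i / slack i p + (1 + 1 / slack i p) * relz p d i) / zc p i) * zc v i
      + rels p d i / slack i p * tc v) + relt p d * relt p v"
    by (simp only: sum.distrib sum_distrib_right distrib_right relt_def)
      (simp add: algebra_simps)
  also have "\<dots> = (\<Sum>i<k. (relz p d i * relz p v i + rels p d i * rels p v i
       + relz p d i * relz p v i / slack i p) + (- relr p d / rest p) * zc v i) + relt p d * relt p v"
  proof -
    have "(- (ds / s)) * x + (- dr / r + (ds / s + (1 + 1 / s) * dz) / z) * vz + ds / s * t
        = dz * (vz / z) + ds * ((vz / z - x + t) / s) + dz * (vz / z) / s + (- dr / r) * vz"
      if "0 < s" "0 < z" "0 < r" for s z r x vz t ds dr dz :: real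
      using that by (simp add: field_simps)
    note e = this[of "slack i p" "zc p i" "rest p" "rels p d i" "a i \<bullet> xc v" "relr p d"
        "relz p d i" "zc v i" "tc v" for i]
    show ?thesis
      unfolding relz_def[of p v] rels_def[of p v]
      by (rule arg_cong2[where f = "(+)", OF sum.cong[OF refl e] refl]) (use assms in \<open>auto simp: pos_def\<close>)
  qed
  also have "(\<Sum>i<k. (relz p d i * relz p v i + rels p d i * rels p v i
       + relz p d i * relz p v i / slack i p) + (- relr p d / rest p) * zc v i)
     = (\<Sum>i<k. relz p d i * relz p v i + rels p d i * rels p v i
       + relz p d i * relz p v i / slack i p) + relr p d * relr p v"
    by (simp only: sum.distrib[of _ "\<lambda>i. _ * zc v i"] sum_distrib_left[symmetric] relr_def[of p v]) simp
  finally show ?thesis by (simp add: hform_def)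
qed

lemma deriv_zc: "((\<lambda>p. zc p i) has_derivative (\<lambda>v. zc v i)) net"
  by (auto intro!: derivative_eq_intros)

lemma deriv_slack:
  assumes "pos p" "i < k"
  shows "(slack i has_derivative (\<lambda>v. rels p v i * slack i p)) (at p)"
proof -
  have "0 < zc p i" "0 < slack i p" using assms by (auto simp: pos_def)
  then show ?thesis
    unfolding slack_def[abs_def] rels_def relz_def
    by (auto intro!: derivative_eq_intros simp: slack_def inverse_eq_divide)
qed

lemma deriv_rest: "(rest has_derivative (\<lambda>v. - (\<Sum>i<k. zc v i))) (at p)"
  unfolding rest_def[abs_def] by (auto intro!: derivative_eq_intros)

lemma barrier_gderiv:
  assumes p: "pos p"
  shows "GDERIV (barrier I) p :> bgrad p"
proof -
  note pp = p[unfolded pos_def]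
  have "((\<lambda>p. - (\<Sum>i<k. ln (zc p i)) - (\<Sum>i<k. ln (slack i p)) - ln (tmax - tc p) - ln (rest p))
     has_derivative (\<lambda>v. - (\<Sum>i<k. zc v i * inverse (zc p i))
       - (\<Sum>i<k. (rels p v i * slack i p) * inverse (slack i p)) - (0 - tc v) * inverse (tmax - tc p)
       - (- (\<Sum>i<k. zc v i)) * inverse (rest p))) (at p)"
    using pp by (intro has_derivative_diff has_derivative_minus has_derivative_sum
        has_derivative_ln deriv_zc deriv_slack[OF p] deriv_rest has_derivative_const
        has_derivative_snd has_derivative_ident) auto
  then show ?thesis
    unfolding gderiv_def barrier_eq[abs_def]
  proof (rule has_derivative_eq_rhs)
    show "(\<lambda>v. - (\<Sum>i<k. zc v i * inverse (zc p i))
       - (\<Sum>i<k. (rels p v i * slack i p) * inverse (slack i p)) - (0 - tc v) * inverse (tmax - tc p)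
       - (- (\<Sum>i<k. zc v i)) * inverse (rest p)) = (\<lambda>h. h \<bullet> bgrad p)"
    proof
      fix v
      have "(\<Sum>i<k. (rels p v i * slack i p) * inverse (slack i p)) = (\<Sum>i<k. rels p v i)"
        using pp by (intro sum.cong) auto
      moreover have "(\<Sum>i<k. zc v i * inverse (zc p i)) = (\<Sum>i<k. relz p v i)"
        by (simp add: relz_def divide_inverse mult.commute)
      ultimately show "- (\<Sum>i<k. zc v i * inverse (zc p i))
       - (\<Sum>i<k. (rels p v i * slack i p) * inverse (slack i p)) - (0 - tc v) * inverse (tmax - tc p)
       - (- (\<Sum>i<k. zc v i)) * inverse (rest p) = v \<bullet> bgrad p"
        unfolding inner_commute[of v] bgrad_inner[OF p]
        by (simp add: sum.distrib relt_def relr_def divide_inverse mult.commute)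
    qed
  qed
qed

lemma bgrad_deriv:
  assumes p: "pos p"
  shows "(bgrad has_derivative bhess p) (at p)"
proof -
  note pp = p[unfolded pos_def]
  have s: "((\<lambda>p. 1 / slack i p) has_derivative (\<lambda>v. - (rels p v i / slack i p))) (at p)"
    if "i < k" for i
    using pp that by (auto intro!: derivative_eq_intros deriv_slack[OF p] simp: field_simps)
  have z: "((\<lambda>p. 1 / rest p - (1 + 1 / slack i p) / zc p i) has_derivative
     (\<lambda>v. - relr p v / rest p
        + (rels p v i / slack i p + (1 + 1 / slack i p) * relz p v i) / zc p i)) (at p)"
    if i: "i < k" for i
  proof -
    have 1: "((\<lambda>p. 1 / rest p) has_derivative (\<lambda>v. - relr p v / rest p)) (at p)"
      using pp by (auto intro!: derivative_eq_intros deriv_rest simp: relr_def field_simps)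
    have 2: "((\<lambda>p. (1 + 1 / slack i p) / zc p i) has_derivative
       (\<lambda>v. - ((rels p v i / slack i p + (1 + 1 / slack i p) * relz p v i) / zc p i))) (at p)"
    proof -
      have "((\<lambda>p. (1 + 1 / slack i p) / zc p i) has_derivative
         (\<lambda>v. ((0 + - (rels p v i / slack i p)) * zc p i - (1 + 1 / slack i p) * zc v i)
           / (zc p i * zc p i))) (at p)"
        using pp i by (intro has_derivative_divide' has_derivative_add has_derivative_const s deriv_zc) auto
      then show ?thesis
        by (rule has_derivative_eq_rhs) (use pp i in \<open>auto simp: fun_eq_iff relz_def field_simps\<close>)
    qed
    show ?thesis
      by (rule has_derivative_eq_rhs[OF has_derivative_diff[OF 1 2]])
        (simp add: fun_eq_iff)
  qed
  have t: "((\<lambda>p. 1 / (tmax - tc p)) has_derivative (\<lambda>v. - relt p v / (tmax - tc p))) (at p)"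
    using pp by (auto intro!: derivative_eq_intros simp: relt_def field_simps)
  have "((\<lambda>p. (\<Sum>i<k. (1 / slack i p) *\<^sub>R a i,
     \<Sum>i<k. (1 / rest p - (1 + 1 / slack i p) / zc p i) *\<^sub>R unit_fseq i,
     1 / (tmax - tc p) - (\<Sum>i<k. 1 / slack i p))) has_derivative
    (\<lambda>d. (\<Sum>i<k. (- (rels p d i / slack i p)) *\<^sub>R a i,
     \<Sum>i<k. (- relr p d / rest p + (rels p d i / slack i p + (1 + 1 / slack i p) * relz p d i) / zc p i)
        *\<^sub>R unit_fseq i,
     - relt p d / (tmax - tc p) - (\<Sum>i<k. - (rels p d i / slack i p))))) (at p)"
    by (intro has_derivative_Pair has_derivative_diff has_derivative_sum has_derivative_scaleR_left s z t)
      auto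
  then show ?thesis
    unfolding bgrad_def[abs_def] bhess_def[abs_def] by (simp add: sum_negf)
qed

text \<open>Differentiating \<open>gradient\<close> requires its formula on a neighbourhood, not
  just at the point.\<close>

lemma pos_eventually:
  assumes p: "pos p"
  shows "\<forall>\<^sub>F p' in nhds p. pos p'"
proof -
  note pp = p[unfolded pos_def]
  have c: "\<forall>\<^sub>F p' in nhds p. 0 < f p'" if "(f has_derivative f') (at p)" "0 < f p"
    for f :: "point \<Rightarrow> real" and f'
    using has_derivative_continuous[OF that(1)] that(2)
    by (simp add: continuous_within tendsto_at_iff_tendsto_nhds order_tendstoD)
  have "\<forall>\<^sub>F p' in nhds p. \<forall>i\<in>{..<k}. 0 < zc p' i"
    using pp by (intro eventually_ball_finite) (auto intro!: c[OF deriv_zc])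
  moreover have "\<forall>\<^sub>F p' in nhds p. \<forall>i\<in>{..<k}. 0 < slack i p'"
    using pp by (intro eventually_ball_finite) (auto intro!: c[OF deriv_slack[OF p]])
  moreover have "\<forall>\<^sub>F p' in nhds p. 0 < rest p'"
    using pp by (intro c[OF deriv_rest]) auto
  moreover have "\<forall>\<^sub>F p' in nhds p. 0 < tmax - tc p'"
    using pp by (intro c[of _ "\<lambda>v. 0 - tc v"] has_derivative_diff has_derivative_const
        has_derivative_snd has_derivative_ident) auto
  ultimately show ?thesis
    by eventually_elim (auto simp: pos_def)
qed

lemma gradient_objective:
  assumes "pos p"
  shows "gradient (objective I c) p = c + bgrad p"
proof (rule gradient_eqI)
  have "GDERIV (\<lambda>p. c \<bullet> p) p :> c"
    unfolding gderiv_def by (auto intro!: derivative_eq_intros simp: inner_commute)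
  then show "GDERIV (objective I c) p :> c + bgrad p"
    unfolding objective_def[abs_def] using barrier_gderiv[OF assms] by (intro GDERIV_add) auto
qed

lemma hessian_objective:
  assumes "pos p"
  shows "hessian (objective I c) p d \<bullet> v = hform p d v"
proof -
  have "((\<lambda>p. c + bgrad p) has_derivative bhess p) (at p)"
    using bgrad_deriv[OF assms] by (auto intro!: derivative_eq_intros)
  then have "(gradient (objective I c) has_derivative bhess p) (at p)"
  proof (rule has_derivative_transform_eventually)
    show "\<forall>\<^sub>F p' in at p. c + bgrad p' = gradient (objective I c) p'"
      using pos_eventually[OF assms] unfolding eventually_at_filter
      by eventually_elim (simp add: gradient_objective)
  qed (auto simp: gradient_objective[OF assms])
  then have "hessian (objective I c) p = bhess p"
    unfolding hessian_def by (rule frechet_derivative_at[symmetric])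
  then show ?thesis by (simp add: bhess_inner[OF assms])
qed

section \<open>The Newton step\<close>

lemma hform_sym: "hform p v w = hform p w v"
  by (simp add: hform_def mult.commute)

lemma linear_rel:
  "linear (\<lambda>v. relz p v i)" "linear (\<lambda>v. rels p v i)" "linear (relt p)" "linear (relr p)"
proof -
  show 1: "linear (\<lambda>v. relz p v i)"
    by (rule linearI) (simp_all add: relz_def coord_arith add_divide_distrib)
  show "linear (\<lambda>v. rels p v i)"
  proof (rule linearI)
    fix v w :: point and c :: real
    show "rels p (v + w) i = rels p v i + rels p w i"
      unfolding rels_def linear_add[OF 1] add_divide_distrib[symmetric]
      by (simp add: inner_add_right)
    show "rels p (c *\<^sub>R v) i = c *\<^sub>R rels p v i"
      unfolding rels_def linear_scale[OF 1] by (simp add: right_diff_distrib distrib_left)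
  qed
  show "linear (relt p)"
    by (rule linearI) (simp_all add: relt_def diff_divide_distrib)
  show "linear (relr p)"
    by (rule linearI)
      (simp_all add: relr_def coord_arith sum.distrib sum_distrib_left diff_divide_distrib)
qed

lemma linear_hform: "linear (hform p v)"
proof (rule linearI)
  fix w w' :: point and c :: real
  show "hform p v (w + w') = hform p v w + hform p v w'"
    unfolding hform_def linear_rel[THEN linear_add]
    by (simp only: distrib_left add_divide_distrib sum.distrib add_ac)
  have "hform p v (c *\<^sub>R w) = (\<Sum>i<k. c * (relz p v i * relz p w i + rels p v i * rels p w i
       + relz p v i * relz p w i / slack i p))
     + c * (relt p v * relt p w + relr p v * relr p w)"
    unfolding hform_def linear_rel[THEN linear_scale] by (simp add: distrib_left mult.left_commute)
  then show "hform p v (c *\<^sub>R w) = c *\<^sub>R hform p v w"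
    unfolding hform_def sum_distrib_left[symmetric] by (simp only: real_scaleR_def distrib_left)
qed

lemma hform_self:
  "hform p v v = (\<Sum>i<k. (relz p v i)\<^sup>2 + (rels p v i)\<^sup>2 + (relz p v i)\<^sup>2 / slack i p)
     + (relt p v)\<^sup>2 + (relr p v)\<^sup>2"
  by (simp add: hform_def power2_eq_square)

section \<open>Local norms\<close>

definition lnorm :: "point \<Rightarrow> point \<Rightarrow> real" where
  "lnorm p v = sqrt (hform p v v)"

lemma hform_nonneg: "pos p \<Longrightarrow> 0 \<le> hform p v v"
  unfolding hform_self by (intro add_nonneg_nonneg sum_nonneg) (auto simp: pos_def less_imp_le)

lemma lnorm_nonneg: "pos p \<Longrightarrow> 0 \<le> lnorm p v"
  by (simp add: lnorm_def hform_nonneg)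

lemma lnorm_power2: "pos p \<Longrightarrow> (lnorm p v)\<^sup>2 = hform p v v"
  by (simp add: lnorm_def hform_nonneg)

definition cnorm2 :: "point \<Rightarrow> point \<Rightarrow> nat \<Rightarrow> real" where
  "cnorm2 p v i = (relz p v i)\<^sup>2 + (rels p v i)\<^sup>2 + (relz p v i)\<^sup>2 / slack i p"

lemma cnorm2_nonneg: "pos p \<Longrightarrow> i < k \<Longrightarrow> 0 \<le> cnorm2 p v i"
  by (auto simp: cnorm2_def pos_def less_imp_le)

lemma hform_cnorm: "hform p v v = (\<Sum>i<k. cnorm2 p v i) + (relt p v)\<^sup>2 + (relr p v)\<^sup>2"
  by (simp add: hform_self cnorm2_def)

lemma cnorm2_le:
  assumes "pos p" "i < k"
  shows "cnorm2 p v i \<le> hform p v v"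
proof -
  have "cnorm2 p v i \<le> (\<Sum>i<k. cnorm2 p v i)"
    using assms by (intro member_le_sum) (auto simp: cnorm2_nonneg)
  then show ?thesis by (simp add: hform_cnorm add_increasing2)
qed

lemma rel_le_lnorm:
  assumes p: "pos p"
  shows "i < k \<Longrightarrow> \<bar>relz p v i\<bar> \<le> lnorm p v" "i < k \<Longrightarrow> \<bar>rels p v i\<bar> \<le> lnorm p v"
    "\<bar>relt p v\<bar> \<le> lnorm p v" "\<bar>relr p v\<bar> \<le> lnorm p v"
proof -
  have s: "0 \<le> (\<Sum>i<k. cnorm2 p v i)" by (intro sum_nonneg) (auto simp: cnorm2_nonneg p)
  show "\<bar>relt p v\<bar> \<le> lnorm p v" "\<bar>relr p v\<bar> \<le> lnorm p v"
    unfolding lnorm_def using s by (auto intro!: real_le_rsqrt simp: hform_cnorm)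
  assume i: "i < k"
  have "0 < slack i p" using p i by (auto simp: pos_def)
  then have "0 \<le> (relz p v i)\<^sup>2 / slack i p" by simp
  then have "(relz p v i)\<^sup>2 \<le> hform p v v" "(rels p v i)\<^sup>2 \<le> hform p v v"
    using cnorm2_le[OF p i, of v] zero_le_power2[of "relz p v i"] zero_le_power2[of "rels p v i"]
    unfolding cnorm2_def by linarith+
  then show "\<bar>relz p v i\<bar> \<le> lnorm p v" "\<bar>rels p v i\<bar> \<le> lnorm p v"
    unfolding lnorm_def by (auto intro!: real_le_rsqrt)
qed

text \<open>A vanishing local norm forces the z and t parts to vanish, but only says that the x part
  is orthogonal to every \<open>a i\<close>; it vanishes too since it lies in their span
  \<open>W I\<close>.\<close>

lemma hform_pos_def:
  assumes p: "pos p" and v: "v \<in> U" "v \<noteq> 0"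
  shows "0 < hform p v v"
proof (rule ccontr)
  assume "\<not> 0 < hform p v v"
  then have "lnorm p v = 0" using hform_nonneg[OF p, of v] by (simp add: lnorm_def)
  then have r: "i < k \<Longrightarrow> relz p v i = 0" "i < k \<Longrightarrow> rels p v i = 0" "relt p v = 0" for i
    using rel_le_lnorm(1)[OF p, of i v] rel_le_lnorm(2)[OF p, of i v] rel_le_lnorm(3)[OF p, of v] by auto
  have 0: "i < k \<Longrightarrow> zc v i = 0" for i
    using r(1)[of i] p by (auto simp: relz_def pos_def)
  have t: "tc v = 0" using r(3) p by (auto simp: relt_def pos_def)
  have x: "i < k \<Longrightarrow> a i \<bullet> xc v = 0" for i
    using r(1,2)[of i] p t by (auto simp: rels_def pos_def)
  have "y \<bullet> xc v = 0" if "y \<in> span ((\<lambda>i. a i) ` {..<k})" for y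
    using that
  proof (induction rule: span_induct)
    case base
    show ?case by (auto simp: subspace_def inner_add_left)
  next
    case (step y)
    then show ?case using x by auto
  qed
  moreover have "xc v \<in> span ((\<lambda>i. a i) ` {..<k})" using v by (auto simp: point_space_def W_def)
  ultimately have "xc v \<bullet> xc v = 0" by blast
  then have "xc v = 0" by simp
  moreover have "fst (snd v) = 0"
  proof (rule fseq_eqI)
    fix i
    have "fst (snd v) \<in> Rn k" using v by (auto simp: point_space_def)
    then show "zc v i = coord 0 i" using 0 by (cases "i < k") (auto simp: Rn_def coord_arith)
  qed
  ultimately have "v = 0" using t by (simp add: prod_eq_iff)
  then show False using v by simp
qed

text \<open>\<open>pos_def_solve\<close> inducts on a finite set of generators, so the product space
  \<open>U\<close> has to be presented as a span.\<close>

lemma point_space_span: "\<exists>S. finite S \<and> U = span S"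
proof -
  have 1: "(UNIV :: real set) = span {1}"
    by (auto simp: span_singleton)
  define S2 where "S2 = (\<lambda>a. (a, 0::real)) ` (unit_fseq ` {..<k}) \<union> (\<lambda>b. (0, b)) ` {1}"
  have 2: "Rn k \<times> (UNIV :: real set) = span S2"
    unfolding Rn_span by (subst 1) (simp only: span_Times S2_def)
  have U: "U = span ((\<lambda>a. (a, 0)) ` ((\<lambda>i. a i) ` {..<k}) \<union> (\<lambda>b. (0, b)) ` S2)"
    unfolding point_space_def 2 W_def by (rule span_Times)
  show ?thesis by (rule exI, rule conjI[OF _ U]) (simp add: S2_def)
qed

lemma subspace_U: "subspace U"
proof -
  obtain S where "U = span S" using point_space_span by blast
  then show ?thesis by (simp only: subspace_span)
qed

lemma newton_step_eq:
  assumes p: "pos p"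
  obtains d where "newton_step U (objective I c) p = p - d" "d \<in> U"
    "\<And>v. v \<in> U \<Longrightarrow> hform p d v = (c + bgrad p) \<bullet> v"
proof -
  obtain S where S: "finite S" "U = span S" using point_space_span by blast
  have "linear (\<lambda>v. (c + bgrad p) \<bullet> v)"
    by (intro linearI) (auto simp: inner_add_right)
  then have ex: "\<exists>!d. d \<in> U \<and> (\<forall>v\<in>U. hform p d v = (c + bgrad p) \<bullet> v)"
    unfolding S(2) using hform_pos_def[OF p] S
    by (intro pos_def_solve[OF S(1) linear_hform hform_sym]) auto
  define d where "d = (THE d. d \<in> U \<and> (\<forall>v\<in>U. hform p d v = (c + bgrad p) \<bullet> v))"
  have "newton_step U (objective I c) p = p - d"
    unfolding newton_step_def d_def
    using hessian_objective[OF p] gradient_objective[OF p] by simp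
  with theI'[OF ex, folded d_def] that show ?thesis by blast
qed

section \<open>Newton steps in relative coordinates\<close>

text \<open>All arguments of the logarithms except the slacks are affine, so their relative change
  is exactly the logarithmic derivative. The slack alone has an error term, the concavity loss of
  ln.\<close>

lemma step_values:
  assumes p: "pos p"
  shows "i < k \<Longrightarrow> zc y i = zc p i * (1 + relz p (y - p) i)"
    "i < k \<Longrightarrow> -1 < relz p (y - p) i \<Longrightarrow>
       slack i y = slack i p * (1 + rels p (y - p) i) - (relz p (y - p) i - ln (1 + relz p (y - p) i))"
    "tmax - tc y = (tmax - tc p) * (1 + relt p (y - p))"
    "rest y = rest p * (1 + relr p (y - p))"
proof -
  show z: "zc y i = zc p i * (1 + relz p (y - p) i)" if "i < k" for i
    using p that by (auto simp: pos_def relz_def coord_arith field_simps)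
  show "slack i y = slack i p * (1 + rels p (y - p) i) - (relz p (y - p) i - ln (1 + relz p (y - p) i))"
    if i: "i < k" and a: "-1 < relz p (y - p) i"
  proof -
    have "0 < zc p i" "0 < slack i p" using p i by (auto simp: pos_def)
    then have "ln (zc y i) = ln (zc p i) + ln (1 + relz p (y - p) i)"
      unfolding z[OF i] using a by (simp add: ln_mult)
    moreover have "slack i p * rels p (y - p) i = relz p (y - p) i - a i \<bullet> xc (y - p) + tc (y - p)"
      using \<open>0 < slack i p\<close> by (simp add: rels_def)
    ultimately show ?thesis
      by (simp add: distrib_left) (simp add: slack_def inner_diff_right)
  qed
  show "tmax - tc y = (tmax - tc p) * (1 + relt p (y - p))"
    using p by (simp add: pos_def relt_def field_simps)
  show "rest y = rest p * (1 + relr p (y - p))"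
  proof -
    have "0 < rest p" using p by (simp add: pos_def)
    then have "rest p * (1 + relr p (y - p)) = rest p - (\<Sum>i<k. zc (y - p) i)"
      unfolding relr_def by (simp add: right_diff_distrib)
    also have "\<dots> = rest y" by (simp add: rest_def coord_arith sum_subtractf)
    finally show ?thesis by simp
  qed
qed

text \<open>The Newton decrement of the objective with linear part \<open>c\<close> is at most
  \<open>e\<close>, written in dual form on \<open>U\<close>.\<close>

definition near :: "point \<Rightarrow> point \<Rightarrow> real \<Rightarrow> bool" where
  "near c p e \<longleftrightarrow> (\<forall>v\<in>U. \<bar>(c + bgrad p) \<bullet> v\<bar> \<le> e * lnorm p v)"

text \<open>The Dikin ellipsoid of radius 1/20 around a point stays inside the domain.\<close>

lemma pos_step:
  assumes p: "pos p" and small: "hform p (y - p) (y - p) \<le> 1 / 400"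
  shows "pos y"
proof -
  have h: "lnorm p (y - p) \<le> 1 / 20"
    unfolding lnorm_def using small by (intro real_le_lsqrt) (simp_all add: power_divide)
  have "0 < zc y i \<and> 0 < slack i y" if i: "i < k" for i
  proof -
    have s: "0 < slack i p" "0 < zc p i" using p i by (auto simp: pos_def)
    have c: "(relz p (y - p) i)\<^sup>2 + (rels p (y - p) i)\<^sup>2 + (relz p (y - p) i)\<^sup>2 / slack i p \<le> 1 / 400"
      using cnorm2_le[OF p i, of "y - p"] small unfolding cnorm2_def by linarith
    note b = cone_local_bounds[OF s(1) c]
    show ?thesis
      using b(5,6) s step_values(1)[OF p i, of y] step_values(2)[OF p i, of y] by auto
  qed
  moreover have "0 < tmax - tc y" "0 < rest y"
    unfolding step_values(3,4)[OF p, of y]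
    using rel_le_lnorm(3,4)[OF p, of "y - p"] h p by (auto simp: pos_def intro!: mult_pos_pos)
  ultimately show ?thesis by (simp add: pos_def)
qed

text \<open>Term by term, \<open>cone_newton_remainder\<close> handles the pairs of z and slack,
  while the two affine arguments give an exact quadratic error. The step is measured at
  \<open>p\<close> but the test vector at \<open>y\<close>, which is the form \<open>near\<close>
  needs at the new point.\<close>

lemma newton_remainder:
  assumes p: "pos p" and small: "hform p (y - p) (y - p) \<le> 1 / 400"
  shows "\<bar>bgrad y \<bullet> v - bgrad p \<bullet> v - hform p (y - p) v\<bar>
    \<le> 5 * hform p (y - p) (y - p) * lnorm y v"
proof -
  define \<delta> where "\<delta> = y - p"
  have py: "pos y" by (rule pos_step[OF p small])
  define rem where "rem i = - (relz y v i + rels y v i) + (relz p v i + rels p v i)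
      - (relz p \<delta> i * relz p v i + rels p \<delta> i * rels p v i + relz p \<delta> i * relz p v i / slack i p)" for i
  have rem: "\<bar>rem i\<bar> \<le> 5 * cnorm2 p \<delta> i * lnorm y v" if i: "i < k" for i
  proof -
    have s: "0 < slack i p" "0 < zc p i" "0 < zc y i" "0 < slack i y"
      using p py i by (auto simp: pos_def)
    have c: "(relz p \<delta> i)\<^sup>2 + (rels p \<delta> i)\<^sup>2 + (relz p \<delta> i)\<^sup>2 / slack i p \<le> 1 / 400"
      using cnorm2_le[OF p i, of \<delta>] small unfolding cnorm2_def \<delta>_def by linarith
    note b = cone_local_bounds[OF s(1) c]
    have s': "slack i p * (1 + rels p \<delta> i) - (relz p \<delta> i - ln (1 + relz p \<delta> i)) = slack i y"
      using step_values(2)[OF p i, of y] b(5) by (simp add: \<delta>_def)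
    have z: "(1 + relz p \<delta> i) * relz y v i = relz p v i"
      using step_values(1)[OF p i, of y] s b(5) by (simp add: relz_def[of _ v] \<delta>_def)
    have "slack i y * rels y v i = relz y v i - a i \<bullet> xc v + tc v"
      using s by (simp add: rels_def)
    then have "(relz p v i - (relz y v i - slack i y * rels y v i)) / slack i p = rels p v i"
      by (simp add: rels_def[of p])
    with cone_newton_remainder[OF s(1) c, of "relz y v i" "rels y v i"]
    have "\<bar>rem i\<bar> \<le> 5 * cnorm2 p \<delta> i * sqrt (cnorm2 y v i)"
      unfolding s' z by (simp add: rem_def cnorm2_def)
    also have "\<dots> \<le> 5 * cnorm2 p \<delta> i * lnorm y v"
      using cnorm2_nonneg[OF p i] cnorm2_le[OF py i] unfolding lnorm_def
      by (intro mult_left_mono) auto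
    finally show ?thesis .
  qed
  have t: "\<bar>- relt y v + relt p v - relt p \<delta> * relt p v\<bar> \<le> (relt p \<delta>)\<^sup>2 * lnorm y v"
  proof -
    have "relt p v = (1 + relt p \<delta>) * relt y v"
      using step_values(3)[OF p, of y] p py by (auto simp: relt_def[of _ v] \<delta>_def pos_def)
    then have "- relt y v + relt p v - relt p \<delta> * relt p v = - ((relt p \<delta>)\<^sup>2 * relt y v)"
      by (simp add: power2_eq_square algebra_simps)
    then show ?thesis
      using rel_le_lnorm(3)[OF py, of v] by (simp add: abs_mult mult_left_mono)
  qed
  have r: "\<bar>- relr y v + relr p v - relr p \<delta> * relr p v\<bar> \<le> (relr p \<delta>)\<^sup>2 * lnorm y v"
  proof -
    have "relr p v = (1 + relr p \<delta>) * relr y v"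
      using step_values(4)[OF p, of y] p py by (auto simp: relr_def[of _ v] \<delta>_def pos_def)
    then have "- relr y v + relr p v - relr p \<delta> * relr p v = - ((relr p \<delta>)\<^sup>2 * relr y v)"
      by (simp add: power2_eq_square algebra_simps)
    then show ?thesis
      using rel_le_lnorm(4)[OF py, of v] by (simp add: abs_mult mult_left_mono)
  qed
  have "bgrad y \<bullet> v - bgrad p \<bullet> v - hform p \<delta> v = (\<Sum>i<k. rem i)
      + (- relt y v + relt p v - relt p \<delta> * relt p v) + (- relr y v + relr p v - relr p \<delta> * relr p v)"
    unfolding bgrad_inner[OF p] bgrad_inner[OF py] hform_def rem_def
    by (simp add: sum.distrib sum_subtractf sum_negf)
  also have "\<bar>\<dots>\<bar> \<le> (\<Sum>i<k. \<bar>rem i\<bar>) + \<bar>- relt y v + relt p v - relt p \<delta> * relt p v\<bar>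
      + \<bar>- relr y v + relr p v - relr p \<delta> * relr p v\<bar>"
    using sum_abs[of rem "{..<k}"] by linarith
  also have "\<dots> \<le> (\<Sum>i<k. 5 * cnorm2 p \<delta> i * lnorm y v) + (relt p \<delta>)\<^sup>2 * lnorm y v
      + (relr p \<delta>)\<^sup>2 * lnorm y v"
    using rem t r by (intro add_mono sum_mono) auto
  also have "\<dots> \<le> 5 * hform p \<delta> \<delta> * lnorm y v"
  proof -
    have "0 \<le> (relt p \<delta>)\<^sup>2 * lnorm y v" "0 \<le> (relr p \<delta>)\<^sup>2 * lnorm y v"
      using lnorm_nonneg[OF py] by auto
    then show ?thesis
      by (simp add: hform_cnorm sum_distrib_left[symmetric] sum_distrib_right[symmetric] algebra_simps)
  qed
  finally show ?thesis by (simp add: \<delta>_def)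
qed

text \<open>For the Newton direction the gradient at \<open>p\<close> and the Hessian term cancel,
  so the new gradient of the objective is the remainder alone, and 5 * (1/20)^2 = 1/80.\<close>

lemma newton_step_near:
  assumes p: "pos p" "p \<in> U" and near: "near c p (1 / 20)"
  defines "y \<equiv> newton_step U (objective I c) p"
  shows "pos y" "y \<in> U" "near c y (1 / 80)"
proof -
  obtain d where d: "y = p - d" "d \<in> U" "\<And>v. v \<in> U \<Longrightarrow> hform p d v = (c + bgrad p) \<bullet> v"
    using newton_step_eq[OF p(1)] y_def by metis
  have yp: "y - p = - d" using d(1) by simp
  have neg: "hform p (- d) v = - hform p d v" for v
    using linear_neg[OF linear_hform, of p v d] by (simp only: hform_sym[of p _ v])
  have hd: "hform p (y - p) (y - p) = hform p d d"
    unfolding yp using neg[of "- d"] neg[of d] hform_sym[of p d "- d"] by simp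
  have "(lnorm p d)\<^sup>2 \<le> 1 / 20 * lnorm p d"
    using near d(2) d(3)[OF d(2)] lnorm_power2[OF p(1), of d] by (auto simp: near_def abs_le_iff)
  then have "lnorm p d \<le> 1 / 20"
    using lnorm_nonneg[OF p(1), of d] by (cases "lnorm p d = 0") (auto simp: power2_eq_square)
  then have "(lnorm p d)\<^sup>2 \<le> (1 / 20)\<^sup>2" using lnorm_nonneg[OF p(1)] by (intro power_mono) auto
  then have small: "hform p (y - p) (y - p) \<le> 1 / 400"
    using hd by (simp add: lnorm_power2[OF p(1)] power_divide)
  show py: "pos y" by (rule pos_step[OF p(1) small])
  show "y \<in> U" unfolding d(1) using subspace_U p d by (intro subspace_diff) auto
  show "near c y (1 / 80)"
    unfolding near_def
  proof
    fix v assume v: "v \<in> U"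
    have "(c + bgrad y) \<bullet> v = bgrad y \<bullet> v - bgrad p \<bullet> v - hform p (y - p) v"
      using d(3)[OF v] neg[of v] by (simp add: yp inner_add_left)
    then have "\<bar>(c + bgrad y) \<bullet> v\<bar> \<le> 5 * hform p (y - p) (y - p) * lnorm y v"
      using newton_remainder[OF p(1) small, of v] by simp
    also have "\<dots> \<le> 1 / 80 * lnorm y v"
      using small lnorm_nonneg[OF py] by (intro mult_right_mono) auto
    finally show "\<bar>(c + bgrad y) \<bullet> v\<bar> \<le> 1 / 80 * lnorm y v" .
  qed
qed

section \<open>Approximate centers\<close>

text \<open>The role of the barrier parameter: Cauchy-Schwarz over the 2k terms from z and slack
  gives \<open>2 * sqrt k\<close>, and the two remaining logarithms add 1 each. It makes a relative
  parameter change of order \<open>1 / sqrt k\<close> affordable.\<close>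

lemma abs_bgrad_le:
  assumes p: "pos p" and k: "1 \<le> k"
  shows "\<bar>bgrad p \<bullet> v\<bar> \<le> 4 * sqrt k * lnorm p v"
proof -
  let ?s = "\<Sum>i<k. relz p v i + rels p v i"
  have "?s\<^sup>2 \<le> (\<Sum>i<k. 1\<^sup>2) * (\<Sum>i<k. (relz p v i + rels p v i)\<^sup>2)"
    using Cauchy_Schwarz_ineq_sum[of "\<lambda>_. 1" "\<lambda>i. relz p v i + rels p v i" "{..<k}"] by simp
  also have "\<dots> \<le> k * (\<Sum>i<k. 2 * cnorm2 p v i)"
  proof -
    have "(relz p v i + rels p v i)\<^sup>2 \<le> 2 * cnorm2 p v i" if "i < k" for i
    proof -
      have "0 < slack i p" using p that by (auto simp: pos_def)
      then have "0 \<le> (relz p v i)\<^sup>2 / slack i p" by simp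
      moreover have "0 \<le> (relz p v i - rels p v i)\<^sup>2" by simp
      ultimately show ?thesis by (simp add: cnorm2_def power2_sum power2_diff)
    qed
    then show ?thesis by (auto intro!: mult_left_mono sum_mono)
  qed
  also have "\<dots> \<le> k * (4 * hform p v v)"
  proof (intro mult_left_mono)
    have "(\<Sum>i<k. 2 * cnorm2 p v i) = 2 * (\<Sum>i<k. cnorm2 p v i)" by (simp add: sum_distrib_left)
    also have "\<dots> \<le> 2 * hform p v v" by (simp add: hform_cnorm)
    also have "\<dots> \<le> 4 * hform p v v" using hform_nonneg[OF p, of v] by simp
    finally show "(\<Sum>i<k. 2 * cnorm2 p v i) \<le> 4 * hform p v v" .
  qed simp
  also have "\<dots> = (2 * sqrt k * lnorm p v)\<^sup>2"
    by (simp add: power_mult_distrib lnorm_power2[OF p])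
  finally have "\<bar>?s\<bar> \<le> 2 * sqrt k * lnorm p v"
    using lnorm_nonneg[OF p] by (simp add: abs_le_square_iff[symmetric] abs_mult)
  moreover have "lnorm p v \<le> sqrt k * lnorm p v"
    using mult_right_mono[of 1 "sqrt k" "lnorm p v"] lnorm_nonneg[OF p] k by simp
  ultimately show ?thesis
    unfolding bgrad_inner[OF p] using rel_le_lnorm(3,4)[OF p, of v] by linarith
qed

text \<open>With \<open>S\<close> the sum of all linearized ratios of arguments between
  \<open>y\<close> and \<open>p\<close>, the pairing of the gradient with the step is
  \<open>2 * k + 2 - S\<close>, while the local norm of the step is at most \<open>2 * S\<close>
  plus a multiple of \<open>k + 1\<close>. The centering error is a small multiple of that norm, so
  \<open>-S\<close> absorbs it however far away \<open>y\<close> is.\<close>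

lemma near_gap:
  assumes p: "pos p" "p \<in> U" and y: "pos y" "y \<in> U" and near: "near c p (1 / 80)"
  shows "c \<bullet> (p - y) \<le> 4 * (real k + 1)"
proof -
  define v where "v = y - p"
  have v: "v \<in> U" unfolding v_def using subspace_U p y by (intro subspace_diff) auto
  define S where "S = (\<Sum>i<k. (1 + relz p v i) + (1 + rels p v i)) + (1 + relt p v) + (1 + relr p v)"
  have z: "-1 < relz p v i" if i: "i < k" for i
  proof -
    have "0 < zc p i" "0 < zc p i * (1 + relz p v i)"
      using p y i step_values(1)[OF p(1) i, of y] by (auto simp: pos_def v_def)
    then show ?thesis by (simp add: zero_less_mult_iff)
  qed
  have c: "-1 < rels p v i"
    "sqrt (cnorm2 p v i) \<le> 2 * (1 + relz p v i) + 2 * (1 + rels p v i) + 3" if i: "i < k" for i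
  proof -
    have s: "0 < slack i p" using p i by (auto simp: pos_def)
    have "0 < slack i y" using y i by (auto simp: pos_def)
    then have pos: "0 < slack i p * (1 + rels p v i) - (relz p v i - ln (1 + relz p v i))"
      using step_values(2)[OF p(1) i, of y] z[OF i] by (simp add: v_def)
    show "-1 < rels p v i"
      "sqrt (cnorm2 p v i) \<le> 2 * (1 + relz p v i) + 2 * (1 + rels p v i) + 3"
      using cone_far_bound[OF s z[OF i] pos] unfolding cnorm2_def by auto
  qed
  have tr: "-1 < relt p v" "-1 < relr p v"
  proof -
    have "0 < tmax - tc p" "0 < (tmax - tc p) * (1 + relt p v)"
      "0 < rest p" "0 < rest p * (1 + relr p v)"
      using p y step_values(3,4)[OF p(1), of y] by (auto simp: pos_def v_def)
    then show "-1 < relt p v" "-1 < relr p v" by (simp_all add: zero_less_mult_iff)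
  qed
  have S0: "0 \<le> S" unfolding S_def
  proof -
    have "0 \<le> 1 + relz p v i + (1 + rels p v i)" if "i < k" for i
      using z[OF that] c(1)[OF that] by simp
    then have "0 \<le> (\<Sum>i<k. (1 + relz p v i) + (1 + rels p v i))" by (intro sum_nonneg) auto
    then show "0 \<le> (\<Sum>i<k. (1 + relz p v i) + (1 + rels p v i)) + (1 + relt p v) + (1 + relr p v)"
      using tr by linarith
  qed
  have bg: "bgrad p \<bullet> v = 2 * real k + 2 - S"
    unfolding bgrad_inner[OF p(1)] S_def by (simp add: sum.distrib)
  have "lnorm p v \<le> sqrt ((\<Sum>i<k. cnorm2 p v i) + (relt p v)\<^sup>2) + sqrt ((relr p v)\<^sup>2)"
    unfolding lnorm_def hform_cnorm
    by (intro sqrt_add_le_add_sqrt add_nonneg_nonneg sum_nonneg) (auto simp: cnorm2_nonneg p)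
  also have "\<dots> \<le> sqrt (\<Sum>i<k. cnorm2 p v i) + \<bar>relt p v\<bar> + \<bar>relr p v\<bar>"
  proof -
    have "0 \<le> (\<Sum>i<k. cnorm2 p v i)" by (intro sum_nonneg) (auto simp: cnorm2_nonneg p)
    then show ?thesis
      using sqrt_add_le_add_sqrt[of "\<Sum>i<k. cnorm2 p v i" "(relt p v)\<^sup>2"] by simp
  qed
  also have "\<dots> \<le> (\<Sum>i<k. 2 * (1 + relz p v i) + 2 * (1 + rels p v i) + 3)
      + ((1 + relt p v) + 1) + ((1 + relr p v) + 1)"
  proof (intro add_mono)
    show "sqrt (\<Sum>i<k. cnorm2 p v i) \<le> (\<Sum>i<k. 2 * (1 + relz p v i) + 2 * (1 + rels p v i) + 3)"
      using sqrt_sum_le[of "{..<k}" "cnorm2 p v"] c(2) cnorm2_nonneg[OF p(1)]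
      by (intro order.trans[OF sqrt_sum_le sum_mono]) auto
  qed (use tr in \<open>auto simp: abs_le_iff\<close>)
  also have "\<dots> \<le> 2 * S + 2 * (2 * real k + 2)"
    using tr by (simp add: S_def sum.distrib sum_distrib_left[symmetric] algebra_simps)
  finally have ln: "lnorm p v \<le> 2 * S + 2 * (2 * real k + 2)" .
  have "c \<bullet> (p - y) = - ((c + bgrad p) \<bullet> v) + bgrad p \<bullet> v"
    by (simp add: v_def inner_add_left inner_diff_right)
  also have "\<dots> \<le> 1 / 80 * lnorm p v + (2 * real k + 2 - S)"
    using near v bg by (auto simp: near_def abs_le_iff)
  \<comment> \<open>One half is the largest factor for which \<open>S\<close> still cancels; the
    decrement 1/80 is well below it.\<close>
  also have "\<dots> \<le> 1 / 2 * lnorm p v + (2 * real k + 2 - S)"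
    using lnorm_nonneg[OF p(1), of v] by simp
  also have "\<dots> \<le> 1 / 2 * (2 * S + 2 * (2 * real k + 2)) + (2 * real k + 2 - S)"
    using ln by simp
  also have "\<dots> = 4 * (real k + 1)" by (simp add: field_simps)
  finally show ?thesis .
qed

section \<open>Geometry of the instance\<close>

lemma q_pos: "i < k \<Longrightarrow> 0 < q i"
  and a_Rn: "i < k \<Longrightarrow> a i \<in> Rn (dimn I)"
  and prec_pos: "0 < prec I"
  using input subspace_diff[OF subspace_Rn] by (auto simp: scaling_input_def)

lemma shift_in_hull: "shift I \<in> convex hull (Omega I)"
  using wc rel_interior_subset unfolding well_conditioned_def by blast

lemma k_pos: "0 < k"
  using shift_in_hull by (cases "k = 0") (auto simp: Omega_def)

lemma W_Rn: "x \<in> W I \<Longrightarrow> x \<in> Rn (dimn I)"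
  unfolding W_def using span_minimal[OF _ subspace_Rn] a_Rn by (metis (no_types, lifting) imageE lessThan_iff subset_iff)

lemma hull_direction:
  assumes "y \<in> convex hull (Omega I)"
  shows "\<exists>i<k. (y - shift I) \<bullet> x \<le> a i \<bullet> x"
proof (rule ccontr)
  assume c: "\<not> ?thesis"
  have "convex {w. x \<bullet> w < x \<bullet> y}" by (rule convex_halfspace_lt)
  moreover have "Omega I \<subseteq> {w. x \<bullet> w < x \<bullet> y}"
    using c by (auto simp: Omega_def inner_commute inner_diff_right inner_diff_left not_le)
  ultimately have "y \<in> {w. x \<bullet> w < x \<bullet> y}" using assms hull_minimal by blast
  then show False by simp
qed

text \<open>Well-conditioning as an inequality: the point of the ball farthest in direction
  \<open>x\<close> lies in the hull, because the affine hull is \<open>shift I\<close> translated by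
  \<open>W I\<close>, and some exponent reaches at least as far in that direction.\<close>

lemma ball_direction:
  assumes "0 \<le> \<rho>" "cball (shift I) \<rho> \<inter> affine hull (Omega I) \<subseteq> convex hull (Omega I)"
    and x: "x \<in> W I"
  shows "\<exists>i<k. \<rho> * norm x \<le> a i \<bullet> x"
proof (cases "x = 0")
  case True
  then show ?thesis using k_pos by auto
next
  case False
  define y where "y = (\<rho> / norm x) *\<^sub>R x"
  have "shift I \<in> affine hull (Omega I)"
    using shift_in_hull convex_hull_subset_affine_hull by blast
  then have "affine hull (Omega I) = affine hull (insert (shift I) (Omega I))"
    using hull_redundant[of "shift I" affine "Omega I"] by simp
  also have "\<dots> = (\<lambda>x. shift I + x) ` W I"
    unfolding affine_hull_insert_span_gen W_def Omega_def image_image by simp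
  finally have "shift I + y \<in> affine hull (Omega I)"
    using x by (auto simp: y_def W_def span_scale)
  moreover have "shift I + y \<in> cball (shift I) \<rho>"
    using assms False by (simp add: dist_norm y_def)
  ultimately have "shift I + y \<in> convex hull (Omega I)" using assms(2) by blast
  from hull_direction[OF this, of x] show ?thesis
    using False by (auto simp: y_def power2_norm_eq_inner[symmetric] power2_eq_square)
qed

lemma a_norm_le: "i < k \<Longrightarrow> norm (a i) \<le> R_theta I"
  unfolding R_theta_def by (intro Max_ge) auto

lemma R_nonneg: "0 \<le> R_theta I"
  using a_norm_le[OF k_pos] norm_ge_zero order_trans by blast

text \<open>\<open>R_theta I > 0\<close> supplies a nonzero \<open>a j\<close>; testing
  \<open>ball_direction\<close> with it bounds every admissible radius by \<open>R_theta I\<close>,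
  so the supremum defining \<open>r_theta I\<close> is a genuine one.\<close>

lemma r_theta_props:
  assumes R: "0 < R_theta I"
  shows "0 < r_theta I" "r_theta I \<le> R_theta I" "x \<in> W I \<Longrightarrow> \<exists>i<k. r_theta I * norm x \<le> a i \<bullet> x"
proof -
  define S where
    "S = {r. 0 \<le> r \<and> cball (shift I) r \<inter> affine hull (Omega I) \<subseteq> convex hull (Omega I)}"
  have rS: "r_theta I = Sup S" by (simp add: r_theta_def S_def)
  obtain e where e: "0 < e" "e \<in> S"
    using wc unfolding well_conditioned_def mem_rel_interior_cball S_def
    by (auto simp: affine_hull_convex_hull less_imp_le)
  obtain j where j: "j < k" "a j \<noteq> 0"
  proof -
    have "R_theta I \<in> (\<lambda>i. norm (a i)) ` {..<k}"
      unfolding R_theta_def using k_pos by (intro Max_in) auto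
    then obtain j where "j < k" "R_theta I = norm (a j)" by blast
    then show ?thesis using that[of j] R by auto
  qed
  have le: "\<rho> \<le> R_theta I" if \<rho>: "\<rho> \<in> S" for \<rho>
  proof -
    have "a j \<in> W I" using j by (auto simp: W_def intro!: span_base)
    then obtain i where i: "i < k" "\<rho> * norm (a j) \<le> a i \<bullet> a j"
      using ball_direction[of \<rho> "a j"] \<rho> unfolding S_def by blast
    note i(2)
    also have "a i \<bullet> a j \<le> norm (a i) * norm (a j)" by (rule norm_cauchy_schwarz)
    also have "\<dots> \<le> R_theta I * norm (a j)" using a_norm_le i by (intro mult_right_mono) auto
    finally show ?thesis using j by simp
  qed
  have bdd: "bdd_above S" using le by (auto simp: bdd_above_def)
  show "0 < r_theta I" unfolding rS using cSup_upper[OF e(2) bdd] e(1) by linarith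
  show "r_theta I \<le> R_theta I" unfolding rS using e(2) le by (intro cSup_least) auto
  assume x: "x \<in> W I"
  \<comment> \<open>The exponent found by \<open>ball_direction\<close> depends on the radius. The
    maximum \<open>M\<close> does not, so the inequality passes to the supremum.\<close>
  define M where "M = Max ((\<lambda>i. a i \<bullet> x) ` {..<k})"
  have "M \<in> (\<lambda>i. a i \<bullet> x) ` {..<k}" unfolding M_def using k_pos by (intro Max_in) auto
  then obtain m where m: "m < k" "M = a m \<bullet> x" by blast
  have "r_theta I * norm x \<le> M"
  proof (cases "x = 0")
    case False
    have "\<rho> \<le> M / norm x" if \<rho>: "\<rho> \<in> S" for \<rho>
    proof -
      obtain i where i: "i < k" "\<rho> * norm x \<le> a i \<bullet> x"
        using ball_direction[of \<rho> x] \<rho> x unfolding S_def by blast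
      moreover have "a i \<bullet> x \<le> M" unfolding M_def using i by (intro Max_ge) auto
      ultimately show ?thesis using False by (simp add: field_simps)
    qed
    then have "r_theta I \<le> M / norm x" unfolding rS using e(2) by (intro cSup_least) auto
    then show ?thesis using False by (simp add: field_simps)
  qed (use m in simp)
  then show "\<exists>i<k. r_theta I * norm x \<le> a i \<bullet> x" using m by auto
qed

section \<open>Coefficients and the size of the domain\<close>

abbreviation "qmin \<equiv> Min (q ` {..<k})"

lemma qmin: "0 < qmin" "i < k \<Longrightarrow> qmin \<le> q i"
proof -
  have "qmin \<in> q ` {..<k}" using k_pos by (intro Min_in) auto
  then show "0 < qmin" using q_pos by auto
  show "i < k \<Longrightarrow> qmin \<le> q i" by (intro Min_le) auto
qed

lemma q_norm1_eq: "q_norm1 I = (\<Sum>i<k. q i)"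
  unfolding q_norm1_def by (intro sum.cong) (use q_pos in \<open>auto simp: abs_of_pos\<close>)

lemma q_le_norm1: "i < k \<Longrightarrow> q i \<le> q_norm1 I"
  unfolding q_norm1_eq by (intro member_le_sum) (use q_pos in \<open>auto intro: less_imp_le\<close>)

lemma q_norm1_pos: "0 < q_norm1 I"
  using q_le_norm1[OF k_pos] q_pos[OF k_pos] by simp

lemma beta_ge: "real k \<le> beta I"
proof -
  have "real k * qmin \<le> q_norm1 I"
    unfolding q_norm1_eq using sum_bounded_below[of "{..<k}" qmin q] qmin by simp
  then show ?thesis using qmin by (simp add: beta_def field_simps)
qed

text \<open>The length of the interval from \<open>ln qmin\<close> to \<open>tmax\<close>, to which
  \<open>domain_bounds\<close> confines the t coordinate.\<close>

definition width :: real where "width = ln (5 * real k * beta I)"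

lemma width_eq: "width = tmax - ln qmin"
  unfolding width_def beta_def times_divide_eq_right using qmin k_pos q_norm1_pos
  by (intro ln_divide_pos) auto

lemma width_ge: "1 \<le> width"
proof -
  have "exp 1 \<le> (5::real)" using exp_le by simp
  also have "5 * 1 * 1 \<le> 5 * real k * beta I"
    using beta_ge k_pos by (intro mult_mono) auto
  finally have "exp 1 \<le> 5 * real k * beta I" by simp
  then show ?thesis unfolding width_def
    by (metis exp_gt_zero ln_exp ln_le_cancel_iff order_less_le_trans)
qed

lemma zc_bounds:
  assumes "pos p" "i < k"
  shows "0 < zc p i" "zc p i < 1"
proof -
  have "zc p i \<le> (\<Sum>i<k. zc p i)"
    using assms by (intro member_le_sum) (auto simp: pos_def less_imp_le)
  then show "0 < zc p i" "zc p i < 1" using assms by (auto simp: pos_def rest_def)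
qed

text \<open>Since \<open>z < 1\<close>, a positive slack gives
  \<open>a i \<bullet> x < t - ln (q i)\<close> for all i. For the exponent from
  \<open>r_theta_props\<close> the left side is at least \<open>r_theta I * norm x\<close>, which
  bounds t from below and x from above at once.\<close>

lemma domain_bounds:
  assumes R: "0 < R_theta I" and p: "pos p" "p \<in> U"
  shows "tmax - tc p \<le> width" "i < k \<Longrightarrow> slack i p \<le> width + R_theta I * (width / r_theta I)"
proof -
  have x: "xc p \<in> W I" using p by (auto simp: point_space_def)
  have up: "a i \<bullet> xc p < tc p - ln (q i)" if i: "i < k" for i
  proof -
    have "ln (zc p i) < 0" using zc_bounds[OF p(1) i] by simp
    moreover have "0 < slack i p" using p i by (auto simp: pos_def)
    ultimately show ?thesis by (simp add: slack_def)
  qed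
  have lnq: "ln qmin \<le> ln (q i)" if "i < k" for i
    using qmin(1) qmin(2)[OF that] by simp
  obtain j where j: "j < k" "r_theta I * norm (xc p) \<le> a j \<bullet> xc p"
    using r_theta_props(3)[OF R x] by blast
  have r0: "0 \<le> r_theta I * norm (xc p)" using r_theta_props(1)[OF R] by simp
  then show t: "tmax - tc p \<le> width"
    using j(2) up[OF j(1)] lnq[OF j(1)] by (simp add: width_eq)
  have ttop: "tc p < tmax" using p by (simp add: pos_def)
  have "r_theta I * norm (xc p) \<le> width"
    using j(2) up[OF j(1)] lnq[OF j(1)] ttop by (simp add: width_eq)
  then have nx: "norm (xc p) \<le> width / r_theta I"
    using r_theta_props(1)[OF R] by (simp add: field_simps)
  assume i: "i < k"
  have "ln (zc p i) < 0" using zc_bounds[OF p(1) i] by simp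
  moreover have "- (a i \<bullet> xc p) \<le> R_theta I * (width / r_theta I)"
  proof -
    have "- (a i \<bullet> xc p) \<le> norm (a i) * norm (xc p)"
      using Cauchy_Schwarz_ineq2[of "a i" "xc p"] by linarith
    also have "\<dots> \<le> R_theta I * (width / r_theta I)"
      using a_norm_le[OF i] nx R_nonneg by (intro mult_mono) auto
    finally show ?thesis .
  qed
  ultimately show "slack i p \<le> width + R_theta I * (width / r_theta I)"
    using lnq[OF i] ttop by (simp add: slack_def width_eq)
qed

section \<open>The starting point\<close>

text \<open>The constants 2 and 4 leave room on every side: \<open>rest\<close> is 1/2, the slacks
  are \<open>ln (2 * q_norm1 I / q i)\<close>, at least \<open>ln 2\<close>, and the distance to
  \<open>tmax\<close> is \<open>ln (5 / 4)\<close>. Hence the gradient of the barrier here has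
  coefficients of order k.\<close>

definition p0 :: point where
  "p0 = (0, vector k (\<lambda>_. 1 / (2 * real k)), ln (4 * real k * q_norm1 I))"

lemma p0_simps: "xc p0 = 0" "i < k \<Longrightarrow> zc p0 i = 1 / (2 * real k)" "tc p0 = ln (4 * real k * q_norm1 I)"
  by (auto simp: p0_def)

lemma p0_U: "p0 \<in> U"
  by (auto simp: p0_def point_space_def W_def span_0)

lemma ln2_ge: "1 / 2 \<le> ln (2::real)"
  using ln_2_less_1 ln2_ge_two_thirds by simp

lemma p0_vals:
  shows "i < k \<Longrightarrow> 1 / 2 \<le> slack i p0" "rest p0 = 1 / 2" "1 / 5 \<le> tmax - tc p0"
proof -
  have k: "0 < real k" using k_pos by simp
  show "1 / 2 \<le> slack i p0" if i: "i < k"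
  proof -
    have "slack i p0 = ln (1 / (2 * real k)) + ln (4 * real k * q_norm1 I) - ln (q i)"
      unfolding slack_def p0_simps(1,3) p0_simps(2)[OF i] by simp
    also have "ln (1 / (2 * real k)) + ln (4 * real k * q_norm1 I)
        = ln (1 / (2 * real k) * (4 * real k * q_norm1 I))"
      using k q_norm1_pos by (intro ln_mult_pos[symmetric]) auto
    also have "\<dots> - ln (q i) = ln (1 / (2 * real k) * (4 * real k * q_norm1 I) / q i)"
      using k q_norm1_pos q_pos[OF i] by (intro ln_divide_pos[symmetric]) auto
    also have "\<dots> = ln (2 * (q_norm1 I / q i))"
      using k by simp
    finally have eq: "slack i p0 = ln (2 * (q_norm1 I / q i))" .
    have "1 \<le> q_norm1 I / q i" using q_le_norm1[OF i] q_pos[OF i] by simp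
    then have "ln 2 \<le> ln (2 * (q_norm1 I / q i))" by (intro ln_mono) auto
    then show ?thesis using ln2_ge eq by linarith
  qed
  show "rest p0 = 1 / 2"
    using k by (simp add: rest_def p0_simps)
  have "tmax - tc p0 = ln (5 * real k * q_norm1 I / (4 * real k * q_norm1 I))"
    unfolding p0_simps using k q_norm1_pos by (intro ln_divide_pos[symmetric]) auto
  also have "\<dots> = ln (5 / 4)" using k q_norm1_pos by simp
  finally have "tmax - tc p0 = ln (5 / 4)" .
  moreover have "1 / 5 \<le> ln (5 / 4 :: real)"
    using ln_le_minus_one[of "4 / 5 :: real"] ln_inverse[of "4 / 5 :: real"] by simp
  ultimately show "1 / 5 \<le> tmax - tc p0" by simp
qed

lemma p0_pos: "pos p0"
proof -
  have "0 < slack i p0" if "i < k" for i using p0_vals(1)[OF that] by linarith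
  then show ?thesis
    using p0_vals(2,3) k_pos by (auto simp: pos_def p0_simps)
qed

definition kappa :: "point \<Rightarrow> real" where
  "kappa p = 2 * (\<Sum>i<k. slack i p) + 8 * (real k)\<^sup>2 + (4 * real k + 5) * (tmax - tc p)"

text \<open>Each component of \<open>v\<close> is recovered from its relative coordinates at
  \<open>p\<close>, at the price of a factor \<open>slack i p\<close> or \<open>tmax - tc p\<close>.
  The coefficients at \<open>p0\<close> are at most 2 for x, \<open>6 * k\<close> for z and
  \<open>5 + 2 * k\<close> for t; collecting terms gives \<open>kappa\<close>, with
  \<open>2 * k + 6 * k^2\<close> rounded up to \<open>8 * k^2\<close>.\<close>

lemma bgrad_p0_le:
  assumes p: "pos p"
  shows "\<bar>bgrad p0 \<bullet> v\<bar> \<le> kappa p * lnorm p v"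
proof -
  define N where "N = lnorm p v"
  have N: "0 \<le> N" using lnorm_nonneg[OF p] by (simp add: N_def)
  have k: "1 \<le> real k" using k_pos by simp
  define \<tau> where "\<tau> = tmax - tc p"
  have \<tau>: "0 < \<tau>" using p by (simp add: pos_def \<tau>_def)
  have t: "\<bar>tc v\<bar> \<le> \<tau> * N"
  proof -
    have "\<bar>relt p v\<bar> = \<bar>tc v\<bar> / \<tau>" using \<tau> by (simp add: relt_def \<tau>_def)
    then have "\<bar>tc v\<bar> = \<tau> * \<bar>relt p v\<bar>" using \<tau> by simp
    then show ?thesis using rel_le_lnorm(3)[OF p, of v] \<tau> by (simp add: N_def)
  qed
  have ax: "\<bar>a i \<bullet> xc v\<bar> \<le> (1 + slack i p + \<tau>) * N" if i: "i < k" for i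
  proof -
    have s: "0 < slack i p" using p i by (auto simp: pos_def)
    have "a i \<bullet> xc v = relz p v i + tc v - slack i p * rels p v i"
      using s by (simp add: rels_def)
    also have "\<bar>\<dots>\<bar> \<le> \<bar>relz p v i\<bar> + \<bar>tc v\<bar> + slack i p * \<bar>rels p v i\<bar>"
      using s abs_mult[of "slack i p" "rels p v i"] by linarith
    also have "\<dots> \<le> N + \<tau> * N + slack i p * N"
      using rel_le_lnorm(1,2)[OF p i, of v] t s unfolding N_def
      by (intro add_mono mult_left_mono) auto
    finally show ?thesis by (simp add: algebra_simps)
  qed
  have z: "\<bar>zc v i\<bar> \<le> N" if i: "i < k" for i
  proof -
    have z: "zc p i \<le> 1" "0 < zc p i" using zc_bounds[OF p i] by auto
    then have "\<bar>zc v i\<bar> = zc p i * \<bar>relz p v i\<bar>" by (simp add: relz_def)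
    also have "\<dots> \<le> 1 * N" using z rel_le_lnorm(1)[OF p i, of v] unfolding N_def by (intro mult_mono) auto
    finally show ?thesis by simp
  qed
  have l: "0 < 1 / slack i p0" "1 / slack i p0 \<le> 2" if i: "i < k" for i
  proof -
    have "1 / 2 \<le> slack i p0" using p0_vals(1)[OF i] .
    then show "0 < 1 / slack i p0" "1 / slack i p0 \<le> 2" by (auto simp: field_simps)
  qed
  have eq: "bgrad p0 \<bullet> v = (\<Sum>i<k. (1 / slack i p0) * (a i \<bullet> xc v)
      + (1 / rest p0 - (1 + 1 / slack i p0) / zc p0 i) * zc v i)
     + (1 / (tmax - tc p0) - (\<Sum>i<k. 1 / slack i p0)) * tc v"
    by (simp add: bgrad_def inner_prod_def inner_sum_left sum.distrib)
  have "\<bar>bgrad p0 \<bullet> v\<bar>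
      \<le> (\<Sum>i<k. 2 * ((1 + slack i p + \<tau>) * N) + 6 * real k * N) + (5 + 2 * real k) * (\<tau> * N)"
    unfolding eq
  proof (rule order.trans[OF abs_triangle_ineq add_mono])
    show "\<bar>\<Sum>i<k. (1 / slack i p0) * (a i \<bullet> xc v)
      + (1 / rest p0 - (1 + 1 / slack i p0) / zc p0 i) * zc v i\<bar>
      \<le> (\<Sum>i<k. 2 * ((1 + slack i p + \<tau>) * N) + 6 * real k * N)"
    proof (rule sum_abs[THEN order.trans], rule sum_mono)
      fix i assume "i \<in> {..<k}"
      then have i: "i < k" by simp
      have c: "1 / rest p0 - (1 + 1 / slack i p0) / zc p0 i = 2 - 2 * real k * (1 + 1 / slack i p0)"
        using i by (simp add: p0_vals(2) p0_simps)
      have "2 * 1 * 1 \<le> 2 * real k * (1 + 1 / slack i p0)"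
        using l[OF i] k by (intro mult_mono) auto
      moreover have "2 * real k * (1 + 1 / slack i p0) \<le> 2 * real k * 3"
        using l[OF i] k by (intro mult_left_mono) auto
      ultimately have cb: "\<bar>1 / rest p0 - (1 + 1 / slack i p0) / zc p0 i\<bar> \<le> 6 * real k"
        unfolding c by linarith
      have "\<bar>(1 / slack i p0) * (a i \<bullet> xc v)\<bar> \<le> 2 * ((1 + slack i p + \<tau>) * N)"
        unfolding abs_mult using l[OF i] ax[OF i] by (intro mult_mono) auto
      moreover have "\<bar>(1 / rest p0 - (1 + 1 / slack i p0) / zc p0 i) * zc v i\<bar> \<le> 6 * real k * N"
        unfolding abs_mult using cb z[OF i] by (intro mult_mono) auto
      ultimately show "\<bar>(1 / slack i p0) * (a i \<bullet> xc v)
        + (1 / rest p0 - (1 + 1 / slack i p0) / zc p0 i) * zc v i\<bar>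
        \<le> 2 * ((1 + slack i p + \<tau>) * N) + 6 * real k * N" by linarith
    qed
    show "\<bar>(1 / (tmax - tc p0) - (\<Sum>i<k. 1 / slack i p0)) * tc v\<bar> \<le> (5 + 2 * real k) * (\<tau> * N)"
      unfolding abs_mult
    proof (intro mult_mono t)
      have "0 \<le> (\<Sum>i<k. 1 / slack i p0)" using l(1) by (intro sum_nonneg) (auto simp: less_imp_le)
      moreover have "(\<Sum>i<k. 1 / slack i p0) \<le> real k * 2"
        using sum_bounded_above[of "{..<k}" "\<lambda>i. 1 / slack i p0" 2] l(2) by simp
      moreover have "0 \<le> 1 / (tmax - tc p0)" "1 / (tmax - tc p0) \<le> 5"
        using p0_vals(3) by (auto simp: field_simps)
      ultimately show "\<bar>1 / (tmax - tc p0) - (\<Sum>i<k. 1 / slack i p0)\<bar> \<le> 5 + 2 * real k"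
        by linarith
    qed auto
  qed
  also have "\<dots> = (2 * (\<Sum>i<k. slack i p) + (2 * real k + 6 * (real k)\<^sup>2) + (4 * real k + 5) * \<tau>) * N"
  proof -
    have "(\<Sum>i<k. 2 * ((1 + slack i p + \<tau>) * N) + 6 * real k * N)
        = (\<Sum>i<k. (2 * N) * slack i p + (2 + 2 * \<tau> + 6 * real k) * N)"
      by (intro sum.cong) (auto simp: algebra_simps)
    also have "\<dots> = (2 * N) * (\<Sum>i<k. slack i p) + real k * ((2 + 2 * \<tau> + 6 * real k) * N)"
      by (simp add: sum.distrib sum_distrib_left)
    finally show ?thesis by (simp add: power2_eq_square algebra_simps)
  qed
  also have "\<dots> \<le> kappa p * N"
  proof -
    have "real k * 1 \<le> real k * real k" using k by (intro mult_left_mono) auto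
    then show ?thesis unfolding kappa_def \<tau>_def[symmetric] using N
      by (intro mult_right_mono) (auto simp: power2_eq_square)
  qed
  finally show ?thesis by (simp add: N_def)
qed

lemma kappa_nonneg: "pos p \<Longrightarrow> 0 \<le> kappa p"
  unfolding kappa_def by (intro add_nonneg_nonneg mult_nonneg_nonneg sum_nonneg) (auto simp: pos_def less_imp_le)

text \<open>A slack is at most \<open>2 * h * width\<close> on the domain; the three summands of
  \<open>kappa\<close> then contribute 4, 8 and 9 to the constant 21.\<close>

lemma kappa_le:
  assumes R: "0 < R_theta I" and p: "pos p" "p \<in> U"
  shows "kappa p \<le> 21 * (real k)\<^sup>2 * (R_theta I / r_theta I) * width"
proof -
  define h where "h = R_theta I / r_theta I"
  have k: "1 \<le> real k" using k_pos by simp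
  have h: "1 \<le> h" using r_theta_props(1,2)[OF R] by (simp add: h_def)
  have w: "1 \<le> width" by (rule width_ge)
  have wh: "width \<le> h * width" using mult_right_mono[OF h, of width] w by simp
  have h1: "1 \<le> h * width" using wh w by linarith
  have kk1: "real k \<le> (real k)\<^sup>2"
    using mult_right_mono[OF k, of "real k"] by (simp add: power2_eq_square)
  note kk = kk1 order.trans[OF k kk1]
  have s: "(\<Sum>i<k. slack i p) \<le> real k * (2 * (h * width))"
    using sum_bounded_above[of "{..<k}" "\<lambda>i. slack i p" "2 * (h * width)"] domain_bounds(2)[OF R p] wh
    by (fastforce simp: h_def)
  have "kappa p \<le> 2 * (real k * (2 * (h * width))) + 8 * (real k)\<^sup>2 + (4 * real k + 5) * width"
    unfolding kappa_def using s domain_bounds(1)[OF R p] by (intro add_mono mult_left_mono) auto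
  also have "\<dots> \<le> 4 * ((real k)\<^sup>2 * (h * width)) + 8 * ((real k)\<^sup>2 * (h * width))
      + (9 * (real k)\<^sup>2) * (h * width)"
  proof (intro add_mono)
    show "2 * (real k * (2 * (h * width))) \<le> 4 * ((real k)\<^sup>2 * (h * width))"
      using mult_right_mono[OF kk(1), of "4 * (h * width)"] h1 by simp
    show "8 * (real k)\<^sup>2 \<le> 8 * ((real k)\<^sup>2 * (h * width))"
      using mult_left_mono[OF h1, of "8 * (real k)\<^sup>2"] by simp
    have "4 * real k + 5 \<le> 9 * (real k)\<^sup>2" using kk by linarith
    then show "(4 * real k + 5) * width \<le> (9 * (real k)\<^sup>2) * (h * width)"
      using wh w by (intro mult_mono) auto
  qed
  finally show ?thesis by (simp add: h_def algebra_simps)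
qed

section \<open>The objective function\<close>

definition expsum :: "fseq \<Rightarrow> real" where
  "expsum x = (\<Sum>i<k. q i * exp (a i \<bullet> x))"

definition gibbs :: "fseq \<Rightarrow> nat \<Rightarrow> real" where
  "gibbs x i = q i * exp (a i \<bullet> x) / expsum x"

definition grad :: "fseq \<Rightarrow> fseq" where
  "grad x = (\<Sum>i<k. gibbs x i *\<^sub>R a i)"

lemma expsum_pos: "0 < expsum x"
  unfolding expsum_def using k_pos q_pos by (intro sum_pos) auto

lemma gibbs_pos: "i < k \<Longrightarrow> 0 < gibbs x i"
  using expsum_pos q_pos by (simp add: gibbs_def)

lemma gibbs_sum: "(\<Sum>i<k. gibbs x i) = 1"
  using expsum_pos[of x] by (simp add: gibbs_def sum_divide_distrib[symmetric] expsum_def[symmetric])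

lemma F_theta_eq: "F_theta I x = ln (expsum x)"
proof -
  have "(\<Sum>i<k. q i * exp (expo I i \<bullet> x)) = exp (shift I \<bullet> x) * expsum x"
    by (simp add: expsum_def sum_distrib_left inner_diff_left exp_diff)
  then show ?thesis
    using expsum_pos[of x] by (simp add: F_theta_def F_def ln_mult_pos)
qed

lemma gderiv_F_theta: "GDERIV (F_theta I) x :> grad x"
  unfolding F_theta_eq[abs_def] gderiv_def
proof (rule has_derivative_eq_rhs)
  show "((\<lambda>x. ln (expsum x)) has_derivative
      (\<lambda>h. (\<Sum>i<k. q i * (exp (a i \<bullet> x) * (a i \<bullet> h))) * inverse (expsum x))) (at x)"
  proof (rule has_derivative_ln)
    show "(expsum has_derivative (\<lambda>h. \<Sum>i<k. q i * (exp (a i \<bullet> x) * (a i \<bullet> h)))) (at x)"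
      unfolding expsum_def[abs_def] by (auto intro!: derivative_eq_intros sum.cong)
  qed (rule expsum_pos)
  show "(\<lambda>h. (\<Sum>i<k. q i * (exp (a i \<bullet> x) * (a i \<bullet> h))) * inverse (expsum x)) = (\<lambda>h. h \<bullet> grad x)"
    by (auto simp: fun_eq_iff grad_def gibbs_def inner_sum_right sum_distrib_right divide_inverse
        inner_commute[of "a _"] intro!: sum.cong)
qed

lemma gradient_F_theta: "gradient (F_theta I) x = grad x"
  by (rule gradient_eqI[OF gderiv_F_theta])

lemma gradient_F: "gradient (F I) x - shift I = grad x"
proof -
  have "GDERIV (\<lambda>x. F_theta I x + shift I \<bullet> x) x :> grad x + shift I"
    by (intro GDERIV_add gderiv_F_theta)
      (auto simp: gderiv_def inner_commute intro!: derivative_eq_intros)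
  then have "GDERIV (F I) x :> grad x + shift I" by (simp add: F_theta_def)
  then show ?thesis by (simp add: gradient_eqI)
qed

lemma grad_W: "grad x \<in> W I"
  unfolding grad_def W_def by (intro span_sum span_scale span_base) auto

lemma norm_grad_le: "norm (grad x) \<le> R_theta I"
proof -
  have "norm (grad x) \<le> (\<Sum>i<k. gibbs x i * R_theta I)"
    unfolding grad_def using gibbs_pos a_norm_le
    by (intro order.trans[OF norm_sum sum_mono]) (auto simp: less_imp_le intro!: mult_mono)
  then show ?thesis by (simp add: sum_distrib_right[symmetric] gibbs_sum)
qed

text \<open>\<open>expsum (x + y) / expsum x\<close> is the mean of
  \<open>exp (a i \<bullet> y)\<close> under the Gibbs weights. The exponents are at most 1 in size,
  so exp is bounded quadratically, and the linear terms average to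
  \<open>grad x \<bullet> y\<close>.\<close>

lemma F_theta_descent:
  assumes y: "R_theta I * norm y \<le> 1"
  shows "F_theta I (x + y) \<le> F_theta I x + grad x \<bullet> y + (R_theta I * norm y)\<^sup>2"
proof -
  have a: "\<bar>a i \<bullet> y\<bar> \<le> R_theta I * norm y" if "i < k" for i
    using Cauchy_Schwarz_ineq2[of "a i" y] mult_right_mono[OF a_norm_le[OF that], of "norm y"] by simp
  have "expsum (x + y) = expsum x * (\<Sum>i<k. gibbs x i * exp (a i \<bullet> y))"
    using expsum_pos[of x]
    by (simp add: gibbs_def expsum_def[of "x + y"] sum_distrib_left inner_add_right exp_add mult.assoc)
  also have "\<dots> \<le> expsum x * (1 + grad x \<bullet> y + (R_theta I * norm y)\<^sup>2)"
  proof (intro mult_left_mono)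
    have "(\<Sum>i<k. gibbs x i * exp (a i \<bullet> y))
        \<le> (\<Sum>i<k. gibbs x i * (1 + a i \<bullet> y + (R_theta I * norm y)\<^sup>2))"
    proof (intro sum_mono mult_left_mono)
      fix i assume "i \<in> {..<k}"
      then have i: "i < k" by simp
      have "exp (a i \<bullet> y) \<le> 1 + a i \<bullet> y + (a i \<bullet> y)\<^sup>2"
        using a[OF i] y by (intro exp_le_quadratic) auto
      also have "(a i \<bullet> y)\<^sup>2 \<le> (R_theta I * norm y)\<^sup>2"
        using a[OF i] by (intro abs_le_square_iff[THEN iffD1]) auto
      finally show "exp (a i \<bullet> y) \<le> 1 + a i \<bullet> y + (R_theta I * norm y)\<^sup>2" by simp
      show "0 \<le> gibbs x i" using gibbs_pos[OF i] by (simp add: less_imp_le)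
    qed
    also have "\<dots> = 1 + grad x \<bullet> y + (R_theta I * norm y)\<^sup>2"
      by (simp add: distrib_left sum.distrib sum_distrib_right[symmetric] gibbs_sum grad_def inner_sum_left)
    finally show "(\<Sum>i<k. gibbs x i * exp (a i \<bullet> y)) \<le> 1 + grad x \<bullet> y + (R_theta I * norm y)\<^sup>2" .
  qed (use expsum_pos[of x] in simp)
  finally have e: "expsum (x + y) \<le> expsum x * (1 + grad x \<bullet> y + (R_theta I * norm y)\<^sup>2)" .
  \<comment> \<open>The factor dominates a quotient of positive numbers, so its logarithm may be
    taken.\<close>
  then have p: "0 < 1 + grad x \<bullet> y + (R_theta I * norm y)\<^sup>2"
    using expsum_pos[of x] expsum_pos[of "x + y"] by (smt (verit) zero_less_mult_pos)
  have "ln (expsum (x + y)) \<le> ln (expsum x * (1 + grad x \<bullet> y + (R_theta I * norm y)\<^sup>2))"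
    using e expsum_pos[of "x + y"] by (intro ln_mono) auto
  also have "\<dots> = ln (expsum x) + ln (1 + grad x \<bullet> y + (R_theta I * norm y)\<^sup>2)"
    by (rule ln_mult_pos[OF expsum_pos p])
  also have "ln (1 + grad x \<bullet> y + (R_theta I * norm y)\<^sup>2) \<le> grad x \<bullet> y + (R_theta I * norm y)\<^sup>2"
    using ln_le_minus_one[OF p] by simp
  finally show ?thesis by (simp add: F_theta_eq)
qed

text \<open>A gradient step of length factor \<open>1 / (2 * R^2)\<close>, the maximizer of
  \<open>s - R^2 * s^2\<close>, gains a quarter of \<open>norm (grad x)^2 / R^2\<close>. It stays in
  \<open>W I\<close> and needs no minimizer of \<open>F_theta I\<close>.\<close>

lemma norm_grad_gap:
  assumes R: "0 < R_theta I" and x: "x \<in> W I"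
  obtains x' where "x' \<in> W I" "(norm (grad x))\<^sup>2 \<le> 4 * (R_theta I)\<^sup>2 * (F_theta I x - F_theta I x')"
proof -
  define s where "s = 1 / (2 * (R_theta I)\<^sup>2)"
  define y where "y = - (s *\<^sub>R grad x)"
  have s: "0 < s" using R by (simp add: s_def)
  have ny: "R_theta I * norm y = norm (grad x) / (2 * R_theta I)"
    using R by (simp add: y_def s_def power2_eq_square)
  also have "\<dots> \<le> 1" using norm_grad_le[of x] R by simp
  finally have "R_theta I * norm y \<le> 1" .
  from F_theta_descent[OF this, of x]
  have "F_theta I (x + y) \<le> F_theta I x - s * (norm (grad x))\<^sup>2 + (norm (grad x) / (2 * R_theta I))\<^sup>2"
    unfolding ny by (simp add: y_def power2_norm_eq_inner)
  moreover have "s * (norm (grad x))\<^sup>2 - (norm (grad x) / (2 * R_theta I))\<^sup>2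
      = (norm (grad x))\<^sup>2 / (4 * (R_theta I)\<^sup>2)"
    using R by (simp add: s_def power2_eq_square field_simps)
  ultimately have "(norm (grad x))\<^sup>2 / (4 * (R_theta I)\<^sup>2) \<le> F_theta I x - F_theta I (x + y)" by linarith
  then have "(norm (grad x))\<^sup>2 \<le> 4 * (R_theta I)\<^sup>2 * (F_theta I x - F_theta I (x + y))"
    using R by (simp add: pos_divide_le_eq mult.commute)
  moreover have "x + y \<in> W I"
    unfolding y_def using x grad_W[of x] unfolding W_def by (intro span_add span_neg span_scale)
  ultimately show ?thesis using that by blast
qed

section \<open>From the barrier problem back to the gradient\<close>

text \<open>A positive slack says that \<open>z i\<close> exceeds
  \<open>q i * exp (a i \<bullet> x - t)\<close>, and the \<open>z i\<close> sum to less than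
  1.\<close>

lemma F_theta_less_tc:
  assumes p: "pos p"
  shows "F_theta I (xc p) < tc p"
proof -
  have "q i * exp (a i \<bullet> xc p) * exp (- tc p) \<le> zc p i" if i: "i < k" for i
  proof -
    have z: "0 < zc p i" "0 < slack i p" using p i by (auto simp: pos_def)
    then have "ln (q i) + a i \<bullet> xc p - tc p \<le> ln (zc p i)" by (simp add: slack_def)
    then have "exp (ln (q i) + a i \<bullet> xc p - tc p) \<le> exp (ln (zc p i))" by simp
    then show ?thesis using z q_pos[OF i] by (simp add: exp_add exp_diff exp_minus divide_inverse)
  qed
  then have "(\<Sum>i<k. q i * exp (a i \<bullet> xc p) * exp (- tc p)) \<le> (\<Sum>i<k. zc p i)"
    by (intro sum_mono) auto
  also have "\<dots> < 1" using p by (simp add: pos_def rest_def)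
  finally have "expsum (xc p) * exp (- tc p) < 1"
    by (simp add: expsum_def sum_distrib_right)
  then have "expsum (xc p) < exp (tc p)" by (simp add: exp_minus field_simps)
  then show ?thesis using expsum_pos[of "xc p"] unfolding F_theta_eq
    by (metis exp_gt_zero ln_exp ln_less_cancel_iff)
qed

text \<open>The margin \<open>\<mu>\<close> is shared equally: all slacks equal
  \<open>\<mu> / 2\<close>, and the z coordinates sum to \<open>exp (- \<mu> / 2)\<close>.\<close>

lemma epigraph_point:
  assumes x: "x \<in> W I" and \<mu>: "0 < \<mu>" and t: "F_theta I x + \<mu> < tmax"
  obtains y where "pos y" "y \<in> U" "tc y = F_theta I x + \<mu>"
proof -
  define t where "t = F_theta I x + \<mu>"
  define y :: point where "y = (x, vector k (\<lambda>i. q i * exp (a i \<bullet> x) * exp (\<mu> / 2 - t)), t)"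
  have y: "xc y = x" "tc y = t" "\<And>i. i < k \<Longrightarrow> zc y i = q i * exp (a i \<bullet> x) * exp (\<mu> / 2 - t)"
    by (auto simp: y_def)
  have "(\<Sum>i<k. zc y i) = (\<Sum>i<k. q i * exp (a i \<bullet> x) * exp (\<mu> / 2 - t))"
    using y(3) by (intro sum.cong) auto
  also have "\<dots> = expsum x * exp (\<mu> / 2 - t)" by (simp add: expsum_def sum_distrib_right)
  also have "\<dots> = exp (ln (expsum x) + (\<mu> / 2 - t))" using expsum_pos[of x] by (simp add: exp_add)
  also have "\<dots> = exp (- \<mu> / 2)" by (simp add: t_def F_theta_eq)
  also have "\<dots> < 1" using \<mu> by simp
  finally have r: "0 < rest y" by (simp add: rest_def)
  have z: "0 < zc y i" "0 < slack i y" if i: "i < k" for i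
  proof -
    show "0 < zc y i" using q_pos[OF i] by (simp add: y(3)[OF i])
    have "ln (zc y i) = ln (q i) + a i \<bullet> x + (\<mu> / 2 - t)"
      using q_pos[OF i] by (simp add: y(3)[OF i] ln_mult_pos)
    then show "0 < slack i y" using \<mu> by (simp add: slack_def y)
  qed
  have "pos y" using r z t by (simp add: pos_def y t_def)
  moreover have "y \<in> U" using x by (auto simp: y_def point_space_def)
  ultimately show ?thesis using that[of y] by (simp add: y t_def)
qed

text \<open>\<open>near_gap\<close> is applied to points above \<open>x'\<close> in the epigraph.
  Together with \<open>F_theta I (xc p) < tc p\<close> it bounds the possible decrease by
  \<open>4 * (k + 1) / \<eta>\<close>, which \<open>norm_grad_gap\<close> converts, with another
  factor 4.\<close>

lemma near_grad:
  assumes R: "0 < R_theta I" and p: "pos p" "p \<in> U" and \<eta>: "0 < \<eta>" and near: "near (0, 0, \<eta>) p (1 / 80)"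
  shows "\<eta> * (norm (grad (xc p)))\<^sup>2 \<le> 16 * (R_theta I)\<^sup>2 * (real k + 1)"
proof -
  have x: "xc p \<in> W I" using p by (auto simp: point_space_def)
  obtain x' where x': "x' \<in> W I"
    "(norm (grad (xc p)))\<^sup>2 \<le> 4 * (R_theta I)\<^sup>2 * (F_theta I (xc p) - F_theta I x')"
    using norm_grad_gap[OF R x] by blast
  have "0 \<le> 4 * (R_theta I)\<^sup>2 * (F_theta I (xc p) - F_theta I x')"
    using x'(2) zero_le_power2 order_trans by blast
  then have le: "F_theta I x' \<le> F_theta I (xc p)" using R by (simp add: zero_le_mult_iff)
  have tt: "tc p < tmax" using p by (simp add: pos_def)
  have lt: "F_theta I (xc p) < tc p" by (rule F_theta_less_tc[OF p(1)])
  have "tc p - F_theta I x' \<le> 4 * (real k + 1) / \<eta>"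
  proof (rule field_le_epsilon)
    fix e :: real assume e: "0 < e"
    \<comment> \<open>The domain is open, so height \<open>F_theta I x'\<close> itself is only
      approached; the minimum keeps the comparison point below \<open>tmax\<close>.\<close>
    define \<mu> where "\<mu> = min e (tmax - tc p)"
    have \<mu>: "0 < \<mu>" "\<mu> \<le> e" "\<mu> \<le> tmax - tc p" using e tt by (auto simp: \<mu>_def)
    have "F_theta I x' + \<mu> < tmax" using le lt \<mu> by linarith
    then obtain y where y: "pos y" "y \<in> U" "tc y = F_theta I x' + \<mu>"
      using epigraph_point[OF x'(1) \<mu>(1)] by blast
    have "\<eta> * (tc p - tc y) \<le> 4 * (real k + 1)"
      using near_gap[OF p y(1,2) near] by (simp add: inner_prod_def)
    then have "tc p - tc y \<le> 4 * (real k + 1) / \<eta>"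
      using \<eta> by (simp add: pos_le_divide_eq mult.commute)
    then show "tc p - F_theta I x' \<le> 4 * (real k + 1) / \<eta> + e" using y(3) \<mu>(2) by linarith
  qed
  then have "F_theta I (xc p) - F_theta I x' \<le> 4 * (real k + 1) / \<eta>" using lt by linarith
  then have "4 * (R_theta I)\<^sup>2 * (F_theta I (xc p) - F_theta I x') \<le> 4 * (R_theta I)\<^sup>2 * (4 * (real k + 1) / \<eta>)"
    by (intro mult_left_mono) auto
  also have "\<dots> = 16 * (R_theta I)\<^sup>2 * (real k + 1) / \<eta>" by (simp add: algebra_simps)
  finally have "(norm (grad (xc p)))\<^sup>2 \<le> 16 * (R_theta I)\<^sup>2 * (real k + 1) / \<eta>"
    using x'(2) by linarith
  then show ?thesis using \<eta> by (simp add: pos_le_divide_eq mult.commute)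
qed

end

section \<open>The algorithm\<close>

text \<open>Index variables are fixed by hand to prevent capture: 0 is left free for vector
  components, 1 belongs to the sums written here, and 2 to the norm of q in \<open>top_e\<close>,
  which occurs inside sums over 1.\<close>

definition dot_e :: "nat \<Rightarrow> expr" where
  "dot_e i = SumN 1 (Mul (Sub (Expo i 1) (Shift 1)) (CurX 1))"

definition top_e :: "rat \<Rightarrow> expr" where
  "top_e c = Ln (Mul (Mul (Const c) NumK) (SumK 2 (Coef 2)))"

definition slack_e :: "nat \<Rightarrow> expr" where
  "slack_e i = Sub (Add (Sub (Ln (CurZ i)) (dot_e i)) CurT) (Ln (Coef i))"

definition start_z_e :: expr where
  "start_z_e = Div (Const 1) (Mul (Const 2) NumK)"

definition slack0_e :: "nat \<Rightarrow> expr" where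
  "slack0_e i = Sub (Add (Ln start_z_e) (top_e 4)) (Ln (Coef i))"

definition gap_e :: expr where
  "gap_e = Sub (top_e 5) CurT"

definition kappa_e :: expr where
  "kappa_e = Add (Add (Mul (Const 2) (SumK 1 (slack_e 1))) (Mul (Const 8) (Mul NumK NumK)))
     (Mul (Add (Mul (Const 4) NumK) (Const 5)) gap_e)"

definition rate_e :: expr where
  "rate_e = Div (Const 1) (Mul (Const 400) (Sqrt NumK))"

definition switch_e :: "expr \<Rightarrow> expr \<Rightarrow> expr" where
  "switch_e e f = IfLe (Mul (Reg 0) kappa_e) (Div (Const 1) (Const 100)) e f"

text \<open>Registers 0 and 1 hold \<open>\<tau>\<close> and \<open>\<eta>\<close>. The updated
  values enter both the linear part and the next registers, so each Newton step already uses the new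
  parameters.\<close>

definition tau_e :: expr where
  "tau_e = switch_e (Const 0) (Mul (Reg 0) (Sub (Const 1) rate_e))"

text \<open>Once register 0 is 0 the test stays true, so no phase flag is stored. The additive term
  lifts \<open>\<eta>\<close> off 0 at the switch. Scaled by the distance to \<open>tmax\<close>, it
  costs 1/100 in local norm, then and whenever it is added again.\<close>

definition eta_e :: expr where
  "eta_e = switch_e
     (Add (Mul (Reg 1) (Add (Const 1) rate_e)) (Div (Const 1) (Mul (Const 100) gap_e))) (Const 0)"

definition weight_e :: "nat \<Rightarrow> expr" where
  "weight_e i = Mul (Coef i) (Exp (dot_e i))"

definition grad_e :: expr where
  "grad_e = Div (SumK 1 (Mul (weight_e 1) (Sub (Expo 1 0) (Shift 0)))) (SumK 1 (weight_e 1))"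

text \<open>The linear part is \<open>- \<tau>\<close> times the barrier's gradient at
  \<open>p0\<close>, spelled out in coordinates with \<open>1 / rest p0 = 2\<close>, plus
  \<open>\<eta>\<close> in the t component.\<close>

definition path_following :: ipm where
  "path_following = \<lparr>
     start_point = (Const 0, start_z_e, top_e 4),
     start_regs = [Const 1, Const 0],
     stop_test = Sub (Sqrt (SumN 0 (Mul grad_e grad_e))) Eps,
     linear_part =
       (Mul tau_e (Sub (Const 0) (SumK 1 (Mul (Div (Const 1) (slack0_e 1)) (Sub (Expo 1 0) (Shift 0))))),
        Mul tau_e (Sub (Div (Add (Const 1) (Div (Const 1) (slack0_e 0))) start_z_e) (Const 2)),
        Add (Mul tau_e (Sub (SumK 1 (Div (Const 1) (slack0_e 1))) (Div (Const 1) (Sub (top_e 5) (top_e 4)))))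
          eta_e),
     next_regs = [tau_e, eta_e]\<rparr>"

context scaling
begin

definition rate :: real where "rate = 1 / (400 * sqrt (real k))"

definition tau_next :: "point \<Rightarrow> real \<Rightarrow> real" where
  "tau_next p \<tau> = (if \<tau> * kappa p \<le> 1 / 100 then 0 else \<tau> * (1 - rate))"

definition eta_next :: "point \<Rightarrow> real \<Rightarrow> real \<Rightarrow> real" where
  "eta_next p \<tau> \<eta> =
     (if \<tau> * kappa p \<le> 1 / 100 then \<eta> * (1 + rate) + 1 / (100 * (tmax - tc p)) else 0)"

definition cvec :: "real \<Rightarrow> real \<Rightarrow> point" where
  "cvec \<tau> \<eta> = (0, 0, \<eta>) - \<tau> *\<^sub>R bgrad p0"

context
  fixes p :: point and rs :: "real list" and \<alpha> \<beta> :: "nat \<Rightarrow> nat"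
begin

abbreviation "ev e \<equiv> eval_expr I p rs e \<alpha> \<beta>"

lemma eval_top_e: "ev (top_e c) = ln (of_rat c * real k * q_norm1 I)"
  by (simp add: top_e_def q_norm1_eq)

lemma eval_gap_e: "ev gap_e = tmax - tc p"
  by (simp add: gap_e_def eval_top_e)

lemma eval_start_z_e: "ev start_z_e = 1 / (2 * real k)"
  by (simp add: start_z_e_def)

lemma eval_slack0_e: "\<alpha> i < k \<Longrightarrow> ev (slack0_e i) = slack (\<alpha> i) p0"
  by (simp add: slack0_e_def eval_top_e eval_start_z_e slack_def p0_simps)

lemma eval_rate_e: "ev rate_e = rate"
  by (simp add: rate_e_def rate_def)

context
  assumes p: "p \<in> U"
begin

text \<open>The sum runs over the first n coordinates only; it is the full inner product because the
  x part of a point of \<open>U\<close> lies in \<open>Rn (dimn I)\<close>.\<close>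

lemma eval_dot_e: "ev (dot_e i) = a (\<alpha> i) \<bullet> xc p"
proof -
  have "xc p \<in> Rn (dimn I)" using p W_Rn by (auto simp: point_space_def)
  then show ?thesis
    by (simp add: dot_e_def inner_commute[of _ "xc p"] inner_Rn coord_arith mult.commute)
qed

lemma eval_slack_e: "ev (slack_e i) = slack (\<alpha> i) p"
  by (simp add: slack_e_def slack_def eval_dot_e)

lemma eval_weight_e: "ev (weight_e i) = q (\<alpha> i) * exp (a (\<alpha> i) \<bullet> xc p)"
  by (simp add: weight_e_def eval_dot_e)

end

end

lemma eval_kappa_e: "p \<in> U \<Longrightarrow> eval_expr I p rs kappa_e \<alpha> \<beta> = kappa p"
  by (simp add: kappa_e_def eval_slack_e eval_gap_e kappa_def power2_eq_square)

lemma eval_tau_e: "p \<in> U \<Longrightarrow> eval_expr I p [\<tau>, \<eta>] tau_e \<alpha> \<beta> = tau_next p \<tau>"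
  by (simp add: tau_e_def switch_e_def eval_kappa_e eval_rate_e tau_next_def)

lemma eval_eta_e: "p \<in> U \<Longrightarrow> eval_expr I p [\<tau>, \<eta>] eta_e \<alpha> \<beta> = eta_next p \<tau> \<eta>"
  by (simp add: eta_e_def switch_e_def eval_kappa_e eval_rate_e eval_gap_e eta_next_def)

lemma eval_grad_e: "p \<in> U \<Longrightarrow> eval_expr I p rs grad_e \<alpha> \<beta> = coord (grad (xc p)) (\<beta> 0)"
  by (simp add: grad_e_def eval_weight_e grad_def coord_sum coord_arith gibbs_def
      sum_divide_distrib expsum_def)

lemma eval_stop_test:
  assumes p: "p \<in> U"
  shows "eval_scalar I p rs (stop_test path_following) = norm (grad (xc p)) - prec I"
proof -
  have "grad (xc p) \<in> Rn (dimn I)" using grad_W W_Rn by blast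
  then have "norm (grad (xc p)) = sqrt (\<Sum>j<dimn I. coord (grad (xc p)) j * coord (grad (xc p)) j)"
    by (simp add: norm_eq_sqrt_inner inner_Rn)
  then show ?thesis
    by (simp add: eval_scalar_def path_following_def eval_grad_e[OF p])
qed

lemma initial_eq: "initial path_following I = (p0, [1, 0])"
  by (auto simp: initial_def path_following_def eval_point_def eval_scalar_def eval_start_z_e
      eval_top_e p0_def coord_arith intro!: fseq_eqI)

lemma eval_linear_part:
  assumes p: "p \<in> U"
  shows "eval_point I p [\<tau>, \<eta>] (linear_part path_following) = cvec (tau_next p \<tau>) (eta_next p \<tau> \<eta>)"
proof -
  define \<sigma> where "\<sigma> = tau_next p \<tau>"
  have z0: "rest p0 = 1 / 2" by (rule p0_vals)
  have W0: "xc (cvec \<sigma> h) \<in> Rn (dimn I)" for h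
    by (simp add: cvec_def bgrad_def)
      (intro subspace_neg[OF subspace_Rn] subspace_scale[OF subspace_Rn]
        subspace_sum[OF subspace_Rn] a_Rn, simp)
  have x: "vector (dimn I) (\<lambda>j. eval_expr I p [\<tau>, \<eta>] (Mul tau_e (Sub (Const 0)
      (SumK 1 (Mul (Div (Const 1) (slack0_e 1)) (Sub (Expo 1 0) (Shift 0)))))) (\<lambda>_. 0) ((\<lambda>_. 0)(0 := j)))
     = xc (cvec \<sigma> h)" for h
    by (rule vector_coord[OF W0])
      (simp add: eval_tau_e[OF p] \<sigma>_def cvec_def bgrad_def coord_arith coord_sum eval_slack0_e)
  have zR: "fst (snd (cvec \<sigma> h)) \<in> Rn k" for h
  proof -
    have "unit_fseq i \<in> Rn k" if "i < k" for i using that by (auto simp: Rn_def)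
    then show ?thesis
      by (simp add: cvec_def bgrad_def)
        (intro subspace_neg[OF subspace_Rn] subspace_scale[OF subspace_Rn]
          subspace_sum[OF subspace_Rn], simp)
  qed
  have z: "vector k (\<lambda>i. eval_expr I p [\<tau>, \<eta>] (Mul tau_e
      (Sub (Div (Add (Const 1) (Div (Const 1) (slack0_e 0))) start_z_e) (Const 2))) ((\<lambda>_. 0)(0 := i)) (\<lambda>_. 0))
     = fst (snd (cvec \<sigma> h))" for h
  proof (rule vector_coord[OF zR])
    fix i assume i: "i < k"
    have "zc (cvec \<sigma> h) i = - \<sigma> * (\<Sum>j<k. (1 / rest p0 - (1 + 1 / slack j p0) / zc p0 j) * (if i = j then 1 else 0))"
      by (simp add: cvec_def bgrad_def coord_arith coord_sum)
    also have "\<dots> = - \<sigma> * (1 / rest p0 - (1 + 1 / slack i p0) / zc p0 i)"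
      using i by (simp add: if_distrib cong: if_cong)
    finally show "eval_expr I p [\<tau>, \<eta>] (Mul tau_e
      (Sub (Div (Add (Const 1) (Div (Const 1) (slack0_e 0))) start_z_e) (Const 2))) ((\<lambda>_. 0)(0 := i)) (\<lambda>_. 0)
      = zc (cvec \<sigma> h) i"
      using i by (simp add: eval_tau_e[OF p] \<sigma>_def eval_slack0_e eval_start_z_e z0 p0_simps algebra_simps)
  qed
  have t: "eval_scalar I p [\<tau>, \<eta>] (Add (Mul tau_e (Sub (SumK 1 (Div (Const 1) (slack0_e 1)))
      (Div (Const 1) (Sub (top_e 5) (top_e 4))))) eta_e) = tc (cvec \<sigma> (eta_next p \<tau> \<eta>))"
    by (simp add: eval_scalar_def eval_tau_e[OF p] eval_eta_e[OF p] \<sigma>_def cvec_def bgrad_def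
        eval_slack0_e eval_top_e p0_simps algebra_simps)
  show ?thesis
    unfolding path_following_def eval_point_def ipm.simps prod.case x[of "eta_next p \<tau> \<eta>"]
      z[of "eta_next p \<tau> \<eta>"] t \<sigma>_def by simp
qed

lemma iteration_eq:
  assumes p: "p \<in> U"
  shows "iteration path_following I (p, [\<tau>, \<eta>])
    = (newton_step U (objective I (cvec (tau_next p \<tau>) (eta_next p \<tau> \<eta>))) p,
       [tau_next p \<tau>, eta_next p \<tau> \<eta>])"
  unfolding iteration_def prod.case eval_linear_part[OF p]
  by (simp add: path_following_def eval_scalar_def eval_tau_e[OF p] eval_eta_e[OF p])

section \<open>Convergence\<close>

text \<open>The loop invariant. With at most one nonzero parameter, scaling it scales all of
  \<open>cvec \<tau> \<eta>\<close>, so that \<open>rate_cvec_le\<close> applies in either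
  phase.\<close>

definition centered :: "point \<times> real list \<Rightarrow> real \<Rightarrow> real \<Rightarrow> bool" where
  "centered s \<tau> \<eta> \<longleftrightarrow> snd s = [\<tau>, \<eta>] \<and> pos (fst s) \<and> fst s \<in> U \<and> 0 \<le> \<tau> \<and> 0 \<le> \<eta>
     \<and> (\<tau> = 0 \<or> \<eta> = 0) \<and> near (cvec \<tau> \<eta>) (fst s) (1 / 80)"

lemma rate: "0 < rate" "rate \<le> 1 / 400" "rate * sqrt (real k) = 1 / 400"
proof -
  have k: "1 \<le> sqrt (real k)" using k_pos by simp
  then show "0 < rate" "rate * sqrt (real k) = 1 / 400" by (auto simp: rate_def)
  show "rate \<le> 1 / 400" using k by (simp add: rate_def field_simps)
qed

lemma near_mono:
  assumes "near c p e" and "\<And>v. v \<in> U \<Longrightarrow> \<bar>(c' - c) \<bullet> v\<bar> \<le> e' * lnorm p v"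
  shows "near c' p (e + e')"
  unfolding near_def
proof
  fix v assume v: "v \<in> U"
  have "(c' + bgrad p) \<bullet> v = (c + bgrad p) \<bullet> v + (c' - c) \<bullet> v"
    by (simp add: inner_add_left inner_diff_left)
  then show "\<bar>(c' + bgrad p) \<bullet> v\<bar> \<le> (e + e') * lnorm p v"
    using assms v unfolding near_def distrib_right by (smt (verit))
qed

lemma cvec_inner: "cvec \<tau> \<eta> \<bullet> v = \<eta> * tc v - \<tau> * (bgrad p0 \<bullet> v)"
  by (simp add: cvec_def inner_diff_left) (simp add: inner_prod_def)

text \<open>At an approximate center \<open>c\<close> nearly cancels the barrier's gradient, so its
  dual norm is at most \<open>5 * sqrt k\<close>; 5/400 = 1/80 explains the choice of
  \<open>rate\<close>.\<close>

lemma rate_cvec_le: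
  assumes p: "pos p" and near: "near c p (1 / 80)" and v: "v \<in> U"
  shows "rate * \<bar>c \<bullet> v\<bar> \<le> 1 / 80 * lnorm p v"
proof -
  have "\<bar>c \<bullet> v\<bar> \<le> \<bar>(c + bgrad p) \<bullet> v\<bar> + \<bar>bgrad p \<bullet> v\<bar>" by (simp add: inner_add_left)
  also have "\<dots> \<le> 1 / 80 * lnorm p v + 4 * sqrt (real k) * lnorm p v"
    using near v abs_bgrad_le[OF p, of v] k_pos by (intro add_mono) (auto simp: near_def)
  also have "\<dots> \<le> 5 * sqrt (real k) * lnorm p v"
    using mult_right_mono[of 1 "sqrt (real k)" "lnorm p v"] lnorm_nonneg[OF p, of v] k_pos
    by simp
  finally have "rate * \<bar>c \<bullet> v\<bar> \<le> rate * (5 * sqrt (real k) * lnorm p v)"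
    using rate(1) by (intro mult_left_mono) auto
  also have "\<dots> = 5 * (rate * sqrt (real k)) * lnorm p v" by simp
  finally show ?thesis unfolding rate(3) by simp
qed

text \<open>In the first phase the change is \<open>rate\<close> times
  \<open>cvec \<tau> \<eta>\<close>. Otherwise it consists of growing \<open>\<eta>\<close>, adding
  to it, and dropping \<open>\<tau>\<close>, at costs 1/80, 1/100 and 1/100, together below
  3/80.\<close>

lemma parameter_update:
  assumes c: "centered (p, rs) \<tau> \<eta>"
  shows "near (cvec (tau_next p \<tau>) (eta_next p \<tau> \<eta>)) p (1 / 20)"
    "0 \<le> tau_next p \<tau>" "0 \<le> eta_next p \<tau> \<eta>" "tau_next p \<tau> = 0 \<or> eta_next p \<tau> \<eta> = 0"
proof -
  have p: "pos p" "p \<in> U" "0 \<le> \<tau>" "0 \<le> \<eta>" "\<tau> = 0 \<or> \<eta> = 0" "near (cvec \<tau> \<eta>) p (1 / 80)"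
    using c by (auto simp: centered_def)
  define g where "g = tmax - tc p"
  have g: "0 < g" using p by (simp add: pos_def g_def)
  show "0 \<le> tau_next p \<tau>" "0 \<le> eta_next p \<tau> \<eta>" "tau_next p \<tau> = 0 \<or> eta_next p \<tau> \<eta> = 0"
    using p(3,4) rate(1,2) g by (auto simp: tau_next_def eta_next_def g_def[symmetric])
  have "near (cvec (tau_next p \<tau>) (eta_next p \<tau> \<eta>)) p (1 / 80 + 3 / 80)"
  proof (rule near_mono[OF p(6)])
    fix v assume v: "v \<in> U"
    define N where "N = lnorm p v"
    have N: "0 \<le> N" using lnorm_nonneg[OF p(1)] by (simp add: N_def)
    have rc: "rate * \<bar>cvec \<tau> \<eta> \<bullet> v\<bar> \<le> 1 / 80 * N"
      unfolding N_def by (rule rate_cvec_le[OF p(1,6) v])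
    have d: "(cvec \<tau>' \<eta>' - cvec \<tau> \<eta>) \<bullet> v = (\<eta>' - \<eta>) * tc v - (\<tau>' - \<tau>) * (bgrad p0 \<bullet> v)" for \<tau>' \<eta>'
      by (simp add: inner_diff_left cvec_inner algebra_simps)
    show "\<bar>(cvec (tau_next p \<tau>) (eta_next p \<tau> \<eta>) - cvec \<tau> \<eta>) \<bullet> v\<bar> \<le> 3 / 80 * lnorm p v"
    proof (cases "\<tau> * kappa p \<le> 1 / 100")
      case True
      have e: "(cvec (tau_next p \<tau>) (eta_next p \<tau> \<eta>) - cvec \<tau> \<eta>) \<bullet> v
          = rate * (\<eta> * tc v) + tc v / (100 * g) + \<tau> * (bgrad p0 \<bullet> v)"
        unfolding d using True by (simp add: tau_next_def eta_next_def g_def algebra_simps)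
      have 1: "\<bar>rate * (\<eta> * tc v)\<bar> \<le> 1 / 80 * N"
      proof (cases "\<eta> = 0")
        case False
        then have "\<eta> * tc v = cvec \<tau> \<eta> \<bullet> v" using p(5) by (simp add: cvec_inner)
        then show ?thesis using rc rate(1) by (simp add: abs_mult)
      qed (use N in simp)
      have "\<bar>tc v / g\<bar> \<le> N"
        using rel_le_lnorm(3)[OF p(1), of v] by (simp add: relt_def g_def N_def)
      then have 2: "\<bar>tc v / (100 * g)\<bar> \<le> 1 / 100 * N" by (simp add: abs_mult)
      have "\<bar>\<tau> * (bgrad p0 \<bullet> v)\<bar> \<le> \<tau> * (kappa p * N)"
        unfolding N_def using bgrad_p0_le[OF p(1), of v] p(3) by (simp add: abs_mult mult_left_mono)
      also have "\<dots> \<le> 1 / 100 * N"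
        using mult_right_mono[OF True N] by (simp add: mult.assoc)
      finally have 3: "\<bar>\<tau> * (bgrad p0 \<bullet> v)\<bar> \<le> 1 / 100 * N" .
      have "\<bar>(cvec (tau_next p \<tau>) (eta_next p \<tau> \<eta>) - cvec \<tau> \<eta>) \<bullet> v\<bar>
          \<le> 1 / 80 * N + 1 / 100 * N + 1 / 100 * N"
        unfolding e by (intro order.trans[OF abs_triangle_ineq] add_mono 1 2 3)
      then show ?thesis using N by (simp add: N_def[symmetric])
    next
      case False
      then have "\<tau> \<noteq> 0" by auto
      then have "\<eta> = 0" using p(5) by simp
      then have "(cvec (tau_next p \<tau>) (eta_next p \<tau> \<eta>) - cvec \<tau> \<eta>) \<bullet> v = - (rate * (cvec \<tau> \<eta> \<bullet> v))"
        unfolding d cvec_inner using False by (simp add: tau_next_def eta_next_def algebra_simps)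
      then show ?thesis using rc N rate(1) by (simp add: abs_mult N_def[symmetric])
    qed
  qed
  then show "near (cvec (tau_next p \<tau>) (eta_next p \<tau> \<eta>)) p (1 / 20)" by simp
qed

lemma centered_iteration:
  assumes c: "centered s \<tau> \<eta>"
  shows "centered (iteration path_following I s) (tau_next (fst s) \<tau>) (eta_next (fst s) \<tau> \<eta>)"
proof -
  obtain p where s: "s = (p, [\<tau>, \<eta>])" using c by (cases s) (auto simp: centered_def)
  have p: "pos p" "p \<in> U" using c by (auto simp: centered_def s)
  note u = parameter_update[OF c[unfolded s]]
  show ?thesis
    unfolding s iteration_eq[OF p(2)] using u newton_step_near[OF p u(1)]
    by (simp add: centered_def)
qed

lemma centered_run_0: "centered (run path_following I 0) 1 0"
  using p0_pos p0_U lnorm_nonneg[OF p0_pos]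
  by (simp add: run_def initial_eq centered_def near_def cvec_def zero_prod_def[symmetric])

lemma run_Suc: "run A I (Suc m) = iteration A I (run A I m)"
  by (simp add: run_def)

lemma run_centered: "\<exists>\<tau> \<eta>. centered (run path_following I m) \<tau> \<eta>"
proof (induction m)
  case 0
  then show ?case using centered_run_0 by blast
next
  case (Suc m)
  then show ?case unfolding run_Suc using centered_iteration by blast
qed

text \<open>Here \<open>m1\<close> bounds the number of iterations of the first phase, in which \<open>\<tau>\<close> decreases
  geometrically and \<open>\<eta>\<close> is zero.\<close>

lemma run_progress:
  assumes R: "0 < R_theta I"
    and m1: "(1 - rate) ^ m1 * (21 * (real k)\<^sup>2 * (R_theta I / r_theta I) * width) \<le> 1 / 100"
  shows "\<exists>\<tau> \<eta>. centered (run path_following I m) \<tau> \<eta> \<and>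
    (\<tau> = (1 - rate) ^ m \<and> \<eta> = 0 \<and> m \<le> m1 \<or>
     \<tau> = 0 \<and> (1 + rate) ^ (m - m1 - 1) / (100 * width) \<le> \<eta>)"
proof (induction m)
  case 0
  then show ?case using centered_run_0 by auto
next
  case (Suc m)
  then obtain \<tau> \<eta> where c: "centered (run path_following I m) \<tau> \<eta>"
    and alt: "\<tau> = (1 - rate) ^ m \<and> \<eta> = 0 \<and> m \<le> m1 \<or>
     \<tau> = 0 \<and> (1 + rate) ^ (m - m1 - 1) / (100 * width) \<le> \<eta>" by blast
  define p where "p = fst (run path_following I m)"
  have p: "pos p" "p \<in> U" "0 \<le> \<eta>" "0 \<le> \<tau>" using c by (auto simp: centered_def p_def)
  have w: "0 < width" using width_ge by linarith
  have g: "0 < tmax - tc p" "tmax - tc p \<le> width"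
    using p domain_bounds(1)[OF R p(1,2)] by (auto simp: pos_def)
  then have inc: "1 / (100 * width) \<le> 1 / (100 * (tmax - tc p))" by (intro divide_left_mono) auto
  have c': "centered (run path_following I (Suc m)) (tau_next p \<tau>) (eta_next p \<tau> \<eta>)"
    unfolding run_Suc p_def by (rule centered_iteration[OF c])
  have "tau_next p \<tau> = (1 - rate) ^ Suc m \<and> eta_next p \<tau> \<eta> = 0 \<and> Suc m \<le> m1 \<or>
     tau_next p \<tau> = 0 \<and> (1 + rate) ^ (Suc m - m1 - 1) / (100 * width) \<le> eta_next p \<tau> \<eta>"
    using alt
  proof
    assume a: "\<tau> = (1 - rate) ^ m \<and> \<eta> = 0 \<and> m \<le> m1"
    show ?thesis
    proof (cases "\<tau> * kappa p \<le> 1 / 100")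
      \<comment> \<open>As \<open>m \<le> m1\<close>, truncated subtraction makes the exponent 0,
        and the initial \<open>\<eta>\<close> is large enough whenever the switch occurs.\<close>
      case True
      then show ?thesis using a inc by (simp add: tau_next_def eta_next_def)
    next
      case False
      \<comment> \<open>After \<open>m1\<close> reductions the worst-case bound on
        \<open>kappa\<close> would have triggered the switch.\<close>
      have "m \<noteq> m1"
      proof
        assume "m = m1"
        then have "\<tau> * kappa p \<le> (1 - rate) ^ m1 * (21 * (real k)\<^sup>2 * (R_theta I / r_theta I) * width)"
          using a kappa_le[OF R p(1,2)] rate(2) by (intro mult_mono kappa_nonneg p) auto
        then show False using m1 False by linarith
      qed
      then show ?thesis using a False by (simp add: tau_next_def eta_next_def mult.commute)
    qed
  next
    assume a: "\<tau> = 0 \<and> (1 + rate) ^ (m - m1 - 1) / (100 * width) \<le> \<eta>"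
    have "(1 + rate) ^ (Suc m - m1 - 1) / (100 * width) \<le> (1 + rate) * ((1 + rate) ^ (m - m1 - 1) / (100 * width))"
    proof -
      \<comment> \<open>Only an inequality: after an early switch the truncated exponent stays 0
        until \<open>m1 + 1\<close>.\<close>
      have "(1 + rate) ^ (Suc m - m1 - 1) \<le> (1 + rate) ^ Suc (m - m1 - 1)"
        using rate(1) by (intro power_increasing) auto
      then show ?thesis using w by (simp add: divide_right_mono)
    qed
    also have "\<dots> \<le> (1 + rate) * \<eta>" using a rate(1) by (intro mult_left_mono) auto
    also have "\<dots> \<le> eta_next p \<tau> \<eta>"
      using a g by (simp add: eta_next_def mult.commute)
    finally show ?thesis using a by (simp add: tau_next_def)
  qed
  with c' show ?case by blast
qed

section \<open>Number of iterations\<close>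

lemma stopped_iff:
  "stopped path_following I m \<longleftrightarrow> norm (grad (xc (fst (run path_following I m)))) \<le> prec I"
proof -
  obtain \<tau> \<eta> where "centered (run path_following I m) \<tau> \<eta>" using run_centered by blast
  then have "fst (run path_following I m) \<in> U" by (simp add: centered_def)
  then show ?thesis by (simp add: stopped_def split_beta eval_stop_test)
qed

lemma returns_if_stopped:
  assumes M: "stopped path_following I M"
  shows "\<exists>N x. N \<le> M \<and> returns path_following I N x \<and> x \<in> Rn (dimn I) \<and> norm (grad x) \<le> prec I"
proof -
  define N where "N = (LEAST m. stopped path_following I m)"
  define x where "x = xc (fst (run path_following I N))"
  have N: "stopped path_following I N" "N \<le> M" "\<And>m. m < N \<Longrightarrow> \<not> stopped path_following I m"
    unfolding N_def using M by (auto intro: LeastI Least_le dest: not_less_Least)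
  have dom: "fst (run path_following I m) \<in> barrier_domain I" for m
    using run_centered[of m] by (auto simp: centered_def domain_eq)
  have "x \<in> Rn (dimn I)"
    using dom[of N] W_Rn by (auto simp: x_def domain_eq point_space_def)
  moreover have "returns path_following I N x"
    using N dom by (simp add: returns_def x_def)
  ultimately show ?thesis using N(1,2) unfolding stopped_iff x_def[symmetric] by blast
qed

text \<open>By then \<open>\<eta>\<close> exceeds the value at which \<open>near_grad\<close> gives
  a gradient of norm \<open>prec I\<close>. The constant 1600 is its 16 times the 100 from the
  initial \<open>\<eta>\<close>.\<close>

lemma stopped_late:
  assumes R: "0 < R_theta I"
    and m1: "(1 - rate) ^ m1 * (21 * (real k)\<^sup>2 * (R_theta I / r_theta I) * width) \<le> 1 / 100"
    and j: "1600 * width * (R_theta I / prec I)\<^sup>2 * (real k + 1) \<le> (1 + rate) ^ j"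
  shows "stopped path_following I (m1 + 1 + j)"
proof -
  obtain \<tau> \<eta> where c: "centered (run path_following I (m1 + 1 + j)) \<tau> \<eta>"
    and "\<tau> = 0" and \<eta>: "(1 + rate) ^ j / (100 * width) \<le> \<eta>"
    using run_progress[OF R m1, of "m1 + 1 + j"] by auto
  define p where "p = fst (run path_following I (m1 + 1 + j))"
  have w: "0 < width" using width_ge by linarith
  have "1600 * width * (R_theta I / prec I)\<^sup>2 * (real k + 1) / (100 * width) \<le> \<eta>"
    using \<eta> divide_right_mono[OF j, of "100 * width"] w by linarith
  then have \<eta>': "16 * (R_theta I / prec I)\<^sup>2 * (real k + 1) \<le> \<eta>"
    using w by (simp add: mult_ac)
  moreover have "0 < 16 * (R_theta I / prec I)\<^sup>2 * (real k + 1)"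
    using R prec_pos by (intro mult_pos_pos) auto
  ultimately have e0: "0 < \<eta>" by linarith
  have "near (0, 0, \<eta>) p (1 / 80)" "pos p" "p \<in> U"
    using c \<open>\<tau> = 0\<close> by (auto simp: centered_def cvec_def p_def)
  then have "\<eta> * (norm (grad (xc p)))\<^sup>2 \<le> 16 * (R_theta I)\<^sup>2 * (real k + 1)"
    using near_grad[OF R _ _ e0] by blast
  also have "\<dots> = 16 * (R_theta I / prec I)\<^sup>2 * (real k + 1) * (prec I)\<^sup>2"
    using prec_pos by (simp add: power_divide)
  also have "\<dots> \<le> \<eta> * (prec I)\<^sup>2" using \<eta>' by (intro mult_right_mono) auto
  finally have "(norm (grad (xc p)))\<^sup>2 \<le> (prec I)\<^sup>2" using e0 by simp
  then have "norm (grad (xc p)) \<le> prec I"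
    by (rule power2_le_imp_le) (use prec_pos in simp)
  then show ?thesis unfolding stopped_iff p_def[symmetric] .
qed

text \<open>\<open>1 + u + u^2 \<le> 1 + 2 * u\<close> for small u; half the rate is given away
  here.\<close>

lemma exp_le_power:
  "exp (rate / 2 * real j) \<le> (1 + rate) ^ j"
proof -
  have "(rate / 2)\<^sup>2 \<le> rate / 2"
    using mult_right_mono[of "rate / 2" 1 "rate / 2"] rate(1,2) by (simp add: power2_eq_square)
  then have "exp (rate / 2) \<le> 1 + rate"
    using exp_le_quadratic[of "rate / 2"] rate(1,2) by simp
  then have "exp (rate / 2) ^ j \<le> (1 + rate) ^ j" by (intro power_mono) auto
  then show ?thesis by (simp only: exp_of_nat2_mult)
qed

lemma power_le_exp:
  "(1 - rate) ^ m \<le> exp (- (rate * real m))"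
proof -
  have "1 - rate \<le> exp (- rate)" using exp_ge_add_one_self[of "- rate"] by simp
  then have "(1 - rate) ^ m \<le> exp (- rate) ^ m" using rate(2) by (intro power_mono) auto
  then show ?thesis by (simp add: exp_of_nat2_mult[symmetric])
qed

lemma iteration_bound:
  assumes R: "prec I < R_theta I"
  defines "\<Gamma> \<equiv> real k * (R_theta I / r_theta I) * (R_theta I / prec I) * ln (real k * beta I)"
  shows "\<exists>M. stopped path_following I M
    \<and> real M \<le> (1200 * (2 * ln 9600 + 2) + 6) * sqrt (real k) * ln \<Gamma>"
proof -
  have R0: "0 < R_theta I" using R prec_pos by linarith
  define h where "h = R_theta I / r_theta I"
  define e where "e = R_theta I / prec I"
  define l where "l = ln (real k * beta I)"
  have h: "1 \<le> h" using r_theta_props(1,2)[OF R0] by (simp add: h_def)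
  have e: "1 \<le> e" using R prec_pos by (simp add: e_def)
  \<comment> \<open>A single exponent must equal the shift, which makes \<open>R_theta I\<close>
    zero. With \<open>k \<ge> 2\<close> the logarithm of \<open>\<Gamma>\<close> is bounded away
    from 0 and can absorb additive constants.\<close>
  have k1: "k \<noteq> 1"
  proof
    assume k: "k = 1"
    then have "Omega I = {expo I 0}" by (auto simp: Omega_def)
    then have "a 0 = 0" using shift_in_hull by simp
    then have "R_theta I = 0" using k by (simp add: R_theta_def lessThan_Suc)
    then show False using R0 by simp
  qed
  then have k: "2 \<le> real k" using k_pos by simp
  have kb: "4 \<le> real k * beta I"
    using mult_mono[of 2 "real k" 2 "beta I"] k beta_ge by simp
  have l: "1 \<le> l"
  proof -
    have "2 * ln 2 = ln (4::real)" using ln_realpow[of "2::real" 2] by simp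
    also have "\<dots> \<le> l" unfolding l_def using kb by (intro ln_mono) auto
    finally show ?thesis using ln2_ge by linarith
  qed
  \<comment> \<open>The factor 5 inside \<open>width\<close> is absorbed by a power:
    \<open>5 * y \<le> y^3\<close> for \<open>y \<ge> 4\<close>.\<close>
  have w: "width \<le> 3 * l"
  proof -
    have "5 \<le> (real k * beta I)\<^sup>2" using power_mono[OF kb, of 2] by simp
    then have "5 * (real k * beta I) \<le> (real k * beta I) ^ 3"
      using mult_right_mono[of 5 "(real k * beta I)\<^sup>2" "real k * beta I"] kb
      by (simp add: power2_eq_square power3_eq_cube)
    then have "width \<le> ln ((real k * beta I) ^ 3)"
      unfolding width_def using kb by (intro ln_mono) (auto simp: mult.assoc)
    also have "\<dots> = 3 * l" unfolding l_def using kb by (subst ln_realpow) auto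
    finally show ?thesis .
  qed
  have G: "\<Gamma> = real k * h * e * l" by (simp add: \<Gamma>_def h_def e_def l_def)
  have one: "1 \<le> x\<^sup>2" "x \<le> x\<^sup>2" if "1 \<le> x" for x :: real
    using mult_right_mono[OF that, of x] that by (auto simp: power2_eq_square intro: order.trans)
  have "2 * 1 * 1 * 1 \<le> \<Gamma>" unfolding G using k h e l by (intro mult_mono mult_nonneg_nonneg) auto
  then have G2: "2 \<le> \<Gamma>" by simp
  have GG: "\<Gamma>\<^sup>2 = (real k)\<^sup>2 * h\<^sup>2 * e\<^sup>2 * l\<^sup>2" by (simp add: G power_mult_distrib)
  have lnG: "1 / 2 \<le> ln \<Gamma>" using ln2_ge ln_mono[of 2 \<Gamma>] G2 by linarith
  \<comment> \<open>\<open>A\<close> and \<open>B\<close> are the factors by which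
    \<open>\<tau>\<close> must shrink and \<open>\<eta>\<close> must grow. Both are at most
    \<open>9600 * \<Gamma>^2\<close>, where 9600 = 1600 * 3 * 2.\<close>
  define A where "A = 100 * (21 * (real k)\<^sup>2 * h * width)"
  define B where "B = 1600 * width * e\<^sup>2 * (real k + 1)"
  have w1: "1 \<le> width" by (rule width_ge)
  have A: "A \<le> 9600 * \<Gamma>\<^sup>2"
  proof -
    have "A = 2100 * (real k)\<^sup>2 * h * width" by (simp add: A_def)
    also have "\<dots> \<le> 2100 * (real k)\<^sup>2 * h * (3 * l)"
      using w h by (intro mult_left_mono) auto
    also have "\<dots> = 6300 * ((real k)\<^sup>2 * h * 1 * l)" by simp
    also have "\<dots> \<le> 6300 * \<Gamma>\<^sup>2"
      unfolding GG using one[OF h] one[OF e] one[OF l] h l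
      by (intro mult_left_mono mult_mono mult_nonneg_nonneg) auto
    finally show ?thesis using zero_le_power2[of \<Gamma>] by linarith
  qed
  have B: "B \<le> 9600 * \<Gamma>\<^sup>2"
  proof -
    have "B \<le> 1600 * (3 * l) * e\<^sup>2 * (2 * real k)"
      unfolding B_def using w w1 k l by (intro mult_mono mult_nonneg_nonneg) auto
    also have "\<dots> = 9600 * (real k * 1 * e\<^sup>2 * l)" by simp
    also have "\<dots> \<le> 9600 * \<Gamma>\<^sup>2"
      unfolding GG using one[OF h] one[OF l] one[of "real k"] k l
      by (intro mult_left_mono mult_mono mult_nonneg_nonneg) auto
    finally show ?thesis .
  qed
  have A1: "1 \<le> A"
  proof -
    have "1 * 1 * 1 * 1 \<le> 2100 * (real k)\<^sup>2 * h * width"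
      using one[of "real k"] k h w1 by (intro mult_mono mult_nonneg_nonneg) auto
    then show ?thesis by (simp add: A_def)
  qed
  have B1: "1 \<le> B"
  proof -
    have "1 * 1 * 1 * 1 \<le> 1600 * width * e\<^sup>2 * (real k + 1)"
      using one[OF e] k w1 by (intro mult_mono mult_nonneg_nonneg) auto
    then show ?thesis by (simp add: B_def)
  qed
  \<comment> \<open>Since \<open>ln \<Gamma> \<ge> 1/2\<close>, the constant \<open>ln 9600\<close>
    is at most \<open>2 * ln 9600 * ln \<Gamma>\<close>.\<close>
  define c where "c = 2 * ln (9600::real) + 2"
  have lnc: "ln x \<le> c * ln \<Gamma>" if "1 \<le> x" "x \<le> 9600 * \<Gamma>\<^sup>2" for x
  proof -
    have "ln x \<le> ln (9600 * \<Gamma>\<^sup>2)" using that by (intro ln_mono) auto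
    also have "\<dots> = ln 9600 + 2 * ln \<Gamma>" using G2 by (simp add: ln_mult_pos ln_realpow)
    also have "\<dots> \<le> c * ln \<Gamma>"
      using mult_left_mono[OF lnG, of "2 * ln 9600"] by (simp add: c_def algebra_simps)
    finally show ?thesis .
  qed
  define m1 where "m1 = nat \<lceil>ln A / rate\<rceil>"
  define j where "j = nat \<lceil>2 * ln B / rate\<rceil>"
  have m1: "ln A / rate \<le> real m1" "real m1 \<le> ln A / rate + 1"
    using A1 rate(1) unfolding m1_def by (auto intro: real_nat_ceiling_ge simp: of_nat_nat)
  have j: "2 * ln B / rate \<le> real j" "real j \<le> 2 * ln B / rate + 1"
    using B1 rate(1) unfolding j_def by (auto intro: real_nat_ceiling_ge simp: of_nat_nat)
  have "stopped path_following I (m1 + 1 + j)"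
  proof (rule stopped_late[OF R0])
    have "ln A \<le> rate * real m1" using m1(1) rate(1) by (simp add: field_simps)
    then have "exp (- (rate * real m1)) \<le> exp (- ln A)" by simp
    also have "\<dots> = 1 / A" using A1 by (simp add: exp_minus inverse_eq_divide)
    finally have "(1 - rate) ^ m1 * A \<le> 1 / A * A"
      using power_le_exp[of m1] A1 by (intro mult_right_mono) auto
    moreover have "1 / A * A = 1" using A1 by simp
    moreover have "(1 - rate) ^ m1 * A
        = 100 * ((1 - rate) ^ m1 * (21 * (real k)\<^sup>2 * (R_theta I / r_theta I) * width))"
      by (simp add: A_def h_def)
    ultimately show "(1 - rate) ^ m1 * (21 * (real k)\<^sup>2 * (R_theta I / r_theta I) * width) \<le> 1 / 100"
      by linarith
    have "ln B \<le> rate / 2 * real j" using j(1) rate(1) by (simp add: field_simps)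
    then have "exp (ln B) \<le> exp (rate / 2 * real j)" by simp
    then have "B \<le> (1 + rate) ^ j" using exp_le_power[of j] B1 by simp
    then show "1600 * width * (R_theta I / prec I)\<^sup>2 * (real k + 1) \<le> (1 + rate) ^ j"
      by (simp add: B_def e_def)
  qed
  moreover have "real (m1 + 1 + j) \<le> (1200 * c + 6) * sqrt (real k) * ln \<Gamma>"
  proof -
    have inv: "x / rate = 400 * sqrt (real k) * x" for x by (simp add: rate_def)
    have "real (m1 + 1 + j) \<le> 400 * sqrt (real k) * ln A + 400 * sqrt (real k) * (2 * ln B) + 3"
      using m1(2) j(2) unfolding inv by simp
    also have "\<dots> \<le> 400 * sqrt (real k) * (c * ln \<Gamma>) + 400 * sqrt (real k) * (2 * (c * ln \<Gamma>))
        + 6 * (sqrt (real k) * ln \<Gamma>)"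
    proof (intro add_mono mult_left_mono lnc A B A1 B1)
      \<comment> \<open>The 3 collects two roundings and the extra iteration for the switch.\<close>
      have "1 * (1 / 2) \<le> sqrt (real k) * ln \<Gamma>" using k lnG by (intro mult_mono) auto
      then show "3 \<le> 6 * (sqrt (real k) * ln \<Gamma>)" by linarith
    qed auto
    also have "\<dots> = (1200 * c + 6) * sqrt (real k) * ln \<Gamma>" by (simp add: algebra_simps)
    finally show ?thesis .
  qed
  ultimately show ?thesis unfolding c_def by blast
qed

text \<open>If \<open>R_theta I \<le> prec I\<close>, the gradient is small everywhere and the run
  stops at once. This covers the degenerate instance with \<open>R_theta I = 0\<close> and the cases
  in which the logarithm may be negative.\<close>

lemma iteration_bound_max:
  "\<exists>M. stopped path_following I M
    \<and> real M \<le> (1200 * (2 * ln 9600 + 2) + 6) * sqrt (real k) *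
      max 0 (ln (real k * (R_theta I / r_theta I) * (R_theta I / prec I) * ln (real k * beta I)))"
proof (cases "prec I < R_theta I")
  case True
  then obtain M where M: "stopped path_following I M"
    "real M \<le> (1200 * (2 * ln 9600 + 2) + 6) * sqrt (real k) *
      ln (real k * (R_theta I / r_theta I) * (R_theta I / prec I) * ln (real k * beta I))"
    using iteration_bound by blast
  then show ?thesis
    by (intro exI[of _ M] conjI order.trans[OF M(2)] mult_left_mono) auto
next
  case False
  then have "stopped path_following I 0"
    unfolding stopped_iff using norm_grad_le[of "xc (fst (run path_following I 0))"] by linarith
  then show ?thesis by (intro exI[of _ 0]) auto
qed

end

theorem corollary1p7:
  shows "\<exists>(A :: ipm) (C :: real). \<forall>I :: scaling_instance.
    scaling_input I \<and> well_conditioned I \<longrightarrow>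
    (\<exists>(N :: nat) (x :: fseq).
       returns A I N x \<and>
       x \<in> Rn (dimn I) \<and>
       norm (gradient (F_theta I) x) = norm (gradient (F I) x - shift I) \<and>
       norm (gradient (F_theta I) x) \<le> prec I \<and>
       real N \<le> C * sqrt (real (num I)) *
         max 0 (ln (real (num I) * (R_theta I / r_theta I) * (R_theta I / prec I)
                    * ln (real (num I) * beta I))))"
proof (intro exI[of _ path_following] exI[of _ "1200 * (2 * ln 9600 + 2) + 6"] allI impI)
  fix I :: scaling_instance
  assume "scaling_input I \<and> well_conditioned I"
  then interpret scaling I by unfold_locales auto
  obtain M where M: "stopped path_following I M"
    "real M \<le> (1200 * (2 * ln 9600 + 2) + 6) * sqrt (real k) *
      max 0 (ln (real k * (R_theta I / r_theta I) * (R_theta I / prec I) * ln (real k * beta I)))"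
    using iteration_bound_max by blast
  obtain N x where N: "N \<le> M" "returns path_following I N x" "x \<in> Rn (dimn I)" "norm (grad x) \<le> prec I"
    using returns_if_stopped[OF M(1)] by blast
  have "real N \<le> real M" using N(1) by simp
  with M(2) N show "\<exists>N x. returns path_following I N x \<and> x \<in> Rn (dimn I) \<and>
       norm (gradient (F_theta I) x) = norm (gradient (F I) x - shift I) \<and>
       norm (gradient (F_theta I) x) \<le> prec I \<and>
       real N \<le> (1200 * (2 * ln 9600 + 2) + 6) * sqrt (real k) *
         max 0 (ln (real k * (R_theta I / r_theta I) * (R_theta I / prec I) * ln (real k * beta I)))"
    unfolding gradient_F gradient_F_theta by (intro exI[of _ N] exI[of _ x]) linarith
qed

end
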